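(* Let $\mathsf{k}_1,\mathsf{k}_2>0$, $\mathsf{k}_3=(\mathsf{k}_1\mathsf{k}_2)^{-1}$, and let $f^{\mathbf n}$ ($\mathbf n\in\mathscr N_\theta$) and $\mathbf v^{\mathbf n}$ ($\mathbf n\in\mathscr N_{\mathbf u}$) be the functions and vector fields on $\Omega$ defined in the context. Then: (1) For each $\mathbf n\in\mathscr N_{\mathbf u}$, the vector field $\mathbf v^{\mathbf n}$ is divergence-free and satisfies the boundary conditions $v^{\mathbf n}_3=0$ and $\partial_{x_3}v^{\mathbf n}_1=\partial_{x_3}v^{\mathbf n}_2=0$ at $x_3=0$ and $x_3=\pi/\mathsf{k}_3$. (2) $\{f^{\mathbf n}\}_{\mathbf n\in\mathscr N_\theta}$ is an orthonormal basis of $L^2_0$, and $\{\mathbf v^{\mathbf n}\}_{\mathbf n\in\mathscr N_{\mathbf u}}$ is an orthonormal basis of $\mathbf L^2_\sigma$. (3) The following inner product relations hold, where an index on an $f$ ranges over $\mathscr N_\theta$, an index on a $\mathbf v$ ranges over $\mathscr N_{\mathbf u}$, and $\mathbf n=(\mathbf m,\mathbf p,c)$, $\tilde{\mathbf n}=(\tilde{\mathbf m},\tilde{\mathbf p},\tilde c)$: $$\langle f^{\mathbf n}f^{\tilde{\mathbf n}}\rangle=\delta^{\mathbf n,\tilde{\mathbf n}},\qquad \langle \mathbf v^{\mathbf n}\cdot\mathbf v^{\tilde{\mathbf n}}\rangle=\delta^{\mathbf n,\tilde{\mathbf n}},\qquad \langle \mathbf v^{\mathbf n}\cdot(f^{\tilde{\mathbf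 n}}\hat{\mathbf e}^3)\rangle=\frac{\mathcal G^{\mathbf n}_{3,3}\nu_3^{\mathbf n}}{|\mathcal G^{\mathbf n}\boldsymbol\nu^{\mathbf n}|}\,\delta^{\mathbf m,\tilde{\mathbf m}}\delta^{\mathbf p,\tilde{\mathbf p}},$$ $$\langle(\hat{\mathbf e}^3\times\mathbf v^{\tilde{\mathbf n}})\cdot\mathbf v^{\mathbf n}\rangle=(-1)^{|\mathbf p|_1}\,\frac{\delta^{\mathbf m,\tilde{\mathbf m}}\,\delta^{p_1+1,\tilde p_1}\,\delta^{p_2+1,\tilde p_2}}{|\mathcal G^{\tilde{\mathbf n}}\boldsymbol\nu^{\tilde{\mathbf n}}|\,|\mathcal G^{\mathbf n}\boldsymbol\nu^{\mathbf n}|}\big(\mathcal G^{\tilde{\mathbf n}}_{2,2}\mathcal G^{\mathbf n}_{1,1}\nu^{\mathbf n}_1-\mathcal G^{\tilde{\mathbf n}}_{1,1}\mathcal G^{\mathbf n}_{2,2}\nu^{\mathbf n}_2\big).$$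
   Context: Domain and spaces. $\Omega=[0,\frac{2\pi}{\mathsf k_1}]\times[0,\frac{2\pi}{\mathsf k_2}]\times[0,\frac{\pi}{\mathsf k_3}]$ with $\mathsf k_1\mathsf k_2\mathsf k_3=1$; all functions on $\Omega$ are periodic in $x_1$ and $x_2$ (periods $2\pi/\mathsf k_1$, $2\pi/\mathsf k_2$). $\langle g\rangle=\int_\Omega g\,d\mathbf x$. $\hat{\mathbf e}^3=(0,0,1)$, $\mathcal K=\mathrm{diag}[\mathsf k_1,\mathsf k_2,\mathsf k_3]$. $L^2_0$ is the closure in $L^2(\Omega)$ of the smooth horizontally periodic functions vanishing at $x_3=0,\pi/\mathsf k_3$. $\mathbf L^2_\sigma$ is the closure in $L^2(\Omega)^3$ of the smooth horizontally periodic divergence-free vector fields $\mathbf u=(u_1,u_2,u_3)$ satisfying $u_3=0$, $\partial_{x_3}u_1=\partial_{x_3}u_2=0$ at $x_3=0,\pi/\mathsf k_3$ and with $u_1,u_2$ of zero mean over $\Omega$. The inner products are $\langle fg\rangle$ and $\langle\mathbf u\cdot\mathbf v\rangle$. Indices. An index is $\mathbf n=(\mathbf m,\mathbf p,c)$ with wave vector $\mathbf m=(m_1,m_2,m_3)\in\mathbb Z_{\ge0}^3$, phase vector $\mathbf p=(p_1,p_2)\in\{0,1\}^2$ and component index $c\in\{1,2\}$. All arithmetic on phases is mod 2; a dummy phase $p_3:=0$ is used; $|\mathbf p|_1=p_1+p_2$. $\delta$ is the Kronecker delta (for vectors, the product over the entries). Put $s^{m,0}(x)=\cos(mx)$, $s^{m,1}(x)=\sin(mx)$;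 $\iota^{m}=0$ if $m=0$ and $\iota^m=1$ if $m>0$; $\eta^{\mathbf m}=\prod_{k\le3}(\sqrt2)^{\iota^{m_k}}$; $V=(4\pi^3)^{1/2}$. Temperature modes. $\mathscr P^{m}=\{0\}$ if $m=0$ and $\{0,1\}$ if $m>0$. $\mathscr N_\theta=\{(\mathbf m,\mathbf p,1): m_1,m_2\ge0,\ m_3>0,\ \mathbf p\in\mathscr P^{m_1}\times\mathscr P^{m_2}\}$ and $$f^{\mathbf n}(\mathbf x)=\frac{\eta^{\mathbf m}}{V}s^{m_1,p_1}(\mathsf k_1x_1)\,s^{m_2,p_2}(\mathsf k_2x_2)\,s^{m_3,1}(\mathsf k_3x_3).$$ Velocity modes. Let $\boldsymbol\gamma=(1,1,-1)$, and define the diagonal matrices $\mathcal G^{(\mathbf m,\mathbf p,1)}=\mathrm{diag}[\boldsymbol\gamma\times\mathcal K\mathbf m]$, $\mathcal G^{(\mathbf m,\mathbf p,2)}=\mathrm{diag}[\mathcal K\mathbf m\times(\boldsymbol\gamma\times\mathcal K\mathbf m)]$, and the vector $\boldsymbol\nu^{\mathbf n}\in\{0,1\}^3$ by $\nu_i^{\mathbf n}=\prod_{j\le3}(\iota^{m_j})^{p_j+\delta^{i,j}}$ (exponents mod 2, $0^0=1$). Let $\varsigma^{\mathbf p}_{1,1}=(-1)^{p_1}$, $\varsigma^{\mathbf p}_{2,2}=(-1)^{p_2}$, $\varsigma^{\mathbf p}_{3,3}=1$. The vector field $\mathbf v^{\mathbf n}$ has components $$v^{\mathbf n}_i(\mathbf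 x)=\frac{\eta^{\mathbf m}}{|\mathcal G^{\mathbf n}\boldsymbol\nu^{\mathbf n}|V}\,\mathcal G^{\mathbf n}_{i,i}\,\varsigma^{\mathbf p}_{i,i}\prod_{j\le3}s^{m_j,\,p_j+\delta^{i,j}}(\mathsf k_jx_j),\qquad i=1,2,3.$$ The admissible set is $\mathscr N_{\mathbf u}=\{(\mathbf m,\mathbf p,c):\mathbf m\in\mathbb Z_{\ge0}^3\setminus\{\mathbf 0\},\ \mathbf p\in\mathscr P^{\mathbf m}_{\mathbf u},\ c\in\mathscr C^{\mathbf m}_{\mathbf u}\}$, where $\mathscr P^{\mathbf m}_{\mathbf u}=\{0,1\}\times\{1\}$ if $m_1>0,\ m_2=m_3=0$; $\{1\}\times\{0,1\}$ if $m_2>0,\ m_1=m_3=0$; $\{(0,1),(1,0)\}$ if $m_3>0,\ m_1=m_2=0$; $\{0,1\}^2$ otherwise; and $\mathscr C^{\mathbf m}_{\mathbf u}=\{1,2\}$ if $m_1,m_2,m_3>0$, $\{1\}$ otherwise. *)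

theory Defs
  imports "HOL-Analysis.Analysis" "HOL-Library.Z2"
begin

definition Omega :: "real^3 \<Rightarrow> (real^3) set" where
  "Omega k = cbox 0 (vector [2 * pi / k$1, 2 * pi / k$2, pi / k$3])"

text \<open>
  Horizontally periodic functions on \<open>Omega k\<close> are regarded as functions on the infinite layer
  \<open>slab k\<close>, so that their smoothness includes smoothness across the periodic faces.
\<close>

definition slab :: "real^3 \<Rightarrow> (real^3) set" where
  "slab k = {x. 0 \<le> x$3 \<and> x$3 \<le> pi / k$3}"

definition walls :: "real^3 \<Rightarrow> (real^3) set" where
  "walls k = {x. x$3 = 0 \<or> x$3 = pi / k$3}"

definition Omega_integral :: "real^3 \<Rightarrow> (real^3 \<Rightarrow> real) \<Rightarrow> real" where
  "Omega_integral k g = (LINT x|lebesgue_on (Omega k). g x)"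

text \<open>
  Elements of \<open>L2 k\<close> are representatives: functions are not identified when they agree almost
  everywhere on \<open>Omega k\<close>, and their values outside \<open>Omega k\<close> are irrelevant.
  The codomain is \<open>real\<close> (where the inner product is multiplication) or \<open>real^3\<close>.
\<close>

definition L2 :: "real^3 \<Rightarrow> (real^3 \<Rightarrow> 'b::euclidean_space) set" where
  "L2 k = {u. u \<in> borel_measurable (lebesgue_on (Omega k)) \<and>
              integrable (lebesgue_on (Omega k)) (\<lambda>x. (norm (u x))\<^sup>2)}"

definition L2_inner :: "real^3 \<Rightarrow> (real^3 \<Rightarrow> 'b::euclidean_space) \<Rightarrow> (real^3 \<Rightarrow> 'b) \<Rightarrow> real" where
  "L2_inner k u w = Omega_integral k (\<lambda>x. u x \<bullet> w x)"

definition L2_norm :: "real^3 \<Rightarrow> (real^3 \<Rightarrow> 'b::euclidean_space) \<Rightarrow> real" where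
  "L2_norm k u = sqrt (L2_inner k u u)"

definition L2_closure ::
  "real^3 \<Rightarrow> (real^3 \<Rightarrow> 'b::euclidean_space) set \<Rightarrow> (real^3 \<Rightarrow> 'b) set" where
  "L2_closure k S = {u \<in> L2 k. \<forall>\<epsilon>>0. \<exists>w\<in>S \<inter> L2 k. L2_norm k (\<lambda>x. u x - w x) < \<epsilon>}"

text \<open>
  Orthonormal basis in the Hilbert space sense: an orthonormal family in \<open>H\<close> whose finite linear
  combinations are dense in \<open>H\<close>.
\<close>

definition orthonormal_basis ::
  "real^3 \<Rightarrow> (real^3 \<Rightarrow> 'b::euclidean_space) set \<Rightarrow> 'i set \<Rightarrow> ('i \<Rightarrow> real^3 \<Rightarrow> 'b) \<Rightarrow> bool" where
  "orthonormal_basis k H N e \<longleftrightarrow>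
     (\<forall>n\<in>N. e n \<in> H) \<and>
     (\<forall>n\<in>N. \<forall>n'\<in>N. L2_inner k (e n) (e n') = of_bool (n = n')) \<and>
     (\<forall>u\<in>H. \<forall>\<epsilon>>0. \<exists>F a. finite F \<and> F \<subseteq> N \<and>
        L2_norm k (\<lambda>x. u x - (\<Sum>n\<in>F. a n *\<^sub>R e n x)) < \<epsilon>)"

text \<open>
  \<open>C\<^sup>\<infinity>\<close> on a set, up to its boundary: \<open>u\<close> is differentiable within \<open>S\<close> and its partial
  derivatives \<open>D i\<close> are again smooth. On a convex set with nonempty interior, such as \<open>slab k\<close>,
  derivatives within \<open>S\<close> are unique.
\<close>

coinductive smooth_on :: "(real^3) set \<Rightarrow> (real^3 \<Rightarrow> 'b::real_normed_vector) \<Rightarrow> bool"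
  for S :: "(real^3) set" where
  "(\<forall>x\<in>S. (u has_derivative (\<lambda>h. \<Sum>i\<in>UNIV. h$i *\<^sub>R D i x)) (at x within S)) \<Longrightarrow>
   (\<forall>i::3. smooth_on S (D i)) \<Longrightarrow> smooth_on S u"

definition horizontally_periodic :: "real^3 \<Rightarrow> (real^3 \<Rightarrow> 'b) \<Rightarrow> bool" where
  "horizontally_periodic k u \<longleftrightarrow>
     (\<forall>x\<in>slab k. u (x + axis 1 (2 * pi / k$1)) = u x \<and> u (x + axis 2 (2 * pi / k$2)) = u x)"

definition divergence_free :: "real^3 \<Rightarrow> (real^3 \<Rightarrow> real^3) \<Rightarrow> bool" where
  "divergence_free k u \<longleftrightarrow>
     (\<forall>x\<in>slab k. \<exists>J. (u has_derivative J) (at x within slab k) \<and>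
                     (\<Sum>i\<in>UNIV. J (axis i 1) $ i) = 0)"

definition velocity_bc :: "real^3 \<Rightarrow> (real^3 \<Rightarrow> real^3) \<Rightarrow> bool" where
  "velocity_bc k u \<longleftrightarrow>
     (\<forall>x\<in>walls k. u x $ 3 = 0 \<and>
        (\<exists>J. (u has_derivative J) (at x within slab k) \<and>
             J (axis 3 1) $ 1 = 0 \<and> J (axis 3 1) $ 2 = 0))"

definition L2_0 :: "real^3 \<Rightarrow> (real^3 \<Rightarrow> real) set" where
  "L2_0 k = L2_closure k
     {\<phi>. smooth_on (slab k) \<phi> \<and> horizontally_periodic k \<phi> \<and> (\<forall>x\<in>walls k. \<phi> x = 0)}"

definition L2_sigma :: "real^3 \<Rightarrow> (real^3 \<Rightarrow> real^3) set" where
  "L2_sigma k = L2_closure k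
     {u. smooth_on (slab k) u \<and> horizontally_periodic k u \<and>
         divergence_free k u \<and> velocity_bc k u \<and>
         Omega_integral k (\<lambda>x. u x $ 1) = 0 \<and> Omega_integral k (\<lambda>x. u x $ 2) = 0}"

text \<open>
  An index is \<open>(m, p, c)\<close>. Phases have type \<open>bit\<close>, so their arithmetic is modulo 2;
  \<open>of_bit\<close> turns a phase into an exponent 0 or 1 (and \<open>0 ^ 0 = 1\<close>).
\<close>

type_synonym mode_index = "(nat^3) \<times> (bit^2) \<times> nat"

definition phase :: "bit^2 \<Rightarrow> 3 \<Rightarrow> bit" where
  "phase p j = (if j = 1 then p$1 else if j = 2 then p$2 else 0)"

definition trig :: "nat \<Rightarrow> bit \<Rightarrow> real \<Rightarrow> real" where
  "trig m q x = (if q = 0 then cos (real m * x) else sin (real m * x))"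

definition iota :: "nat \<Rightarrow> nat" where
  "iota m = (if m = 0 then 0 else 1)"

definition eta :: "nat^3 \<Rightarrow> real" where
  "eta m = (\<Prod>j\<in>UNIV. sqrt 2 ^ iota (m$j))"

definition Vconst :: real where
  "Vconst = sqrt (4 * pi ^ 3)"

definition diag :: "real^3 \<Rightarrow> real^3^3" where
  "diag d = (\<chi> i j. if i = j then d$i else 0)"

definition temp_phases :: "nat \<Rightarrow> bit set" where
  "temp_phases m = (if m = 0 then {0} else {0, 1})"

definition N_theta :: "mode_index set" where
  "N_theta = {(m, p, c). m$3 > 0 \<and> p$1 \<in> temp_phases (m$1) \<and> p$2 \<in> temp_phases (m$2) \<and> c = 1}"

fun temp_mode :: "real^3 \<Rightarrow> mode_index \<Rightarrow> real^3 \<Rightarrow> real" where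
  "temp_mode k (m, p, c) x =
     eta m / Vconst * trig (m$1) (p$1) (k$1 * x$1) * trig (m$2) (p$2) (k$2 * x$2)
       * trig (m$3) 1 (k$3 * x$3)"

definition gamma_vec :: "real^3" where
  "gamma_vec = vector [1, 1, -1]"

definition wave :: "real^3 \<Rightarrow> nat^3 \<Rightarrow> real^3" where
  "wave k m = diag k *v (\<chi> j. real (m$j))"

fun Gmat :: "real^3 \<Rightarrow> mode_index \<Rightarrow> real^3^3" where
  "Gmat k (m, p, c) =
     (if c = 1 then diag (cross3 gamma_vec (wave k m))
      else diag (cross3 (wave k m) (cross3 gamma_vec (wave k m))))"

fun nu :: "mode_index \<Rightarrow> real^3" where
  "nu (m, p, c) =
     (\<chi> i. \<Prod>j\<in>UNIV. real (iota (m$j)) ^ of_bit (phase p j + of_bool (i = j)))"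

definition varsigma :: "bit^2 \<Rightarrow> real^3^3" where
  "varsigma p = diag (vector [(-1) ^ of_bit (p$1), (-1) ^ of_bit (p$2), 1])"

definition Gnu_norm :: "real^3 \<Rightarrow> mode_index \<Rightarrow> real" where
  "Gnu_norm k n = norm (Gmat k n *v nu n)"

fun vel_mode :: "real^3 \<Rightarrow> mode_index \<Rightarrow> real^3 \<Rightarrow> real^3" where
  "vel_mode k (m, p, c) x =
     (\<chi> i. eta m / (Gnu_norm k (m, p, c) * Vconst) * Gmat k (m, p, c) $ i $ i * varsigma p $ i $ i
           * (\<Prod>j\<in>UNIV. trig (m$j) (phase p j + of_bool (i = j)) (k$j * x$j)))"

definition vel_phases :: "nat^3 \<Rightarrow> (bit^2) set" where
  "vel_phases m =
     (if m$1 > 0 \<and> m$2 = 0 \<and> m$3 = 0 then {p. p$1 \<in> {0, 1} \<and> p$2 = 1}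
      else if m$2 > 0 \<and> m$1 = 0 \<and> m$3 = 0 then {p. p$1 = 1 \<and> p$2 \<in> {0, 1}}
      else if m$3 > 0 \<and> m$1 = 0 \<and> m$2 = 0 then {vector [0, 1], vector [1, 0]}
      else UNIV)"

definition vel_components :: "nat^3 \<Rightarrow> nat set" where
  "vel_components m = (if m$1 > 0 \<and> m$2 > 0 \<and> m$3 > 0 then {1, 2} else {1})"

definition N_u :: "mode_index set" where
  "N_u = {(m, p, c). m \<noteq> 0 \<and> p \<in> vel_phases m \<and> c \<in> vel_components m}"

end

theory Submission
  imports Defs
begin

text \<open>
  Up to constants, every temperature mode and every component of a velocity mode is a product of
  three sines and cosines, so orthogonality reduces to one-dimensional integrals. Density of the
  scalar products in the smooth functions is Stone--Weierstrass on the image of the layer under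
  \<open>x \<mapsto> (exp (i k\<^sub>1x\<^sub>1), exp (i k\<^sub>2x\<^sub>2), cos (k\<^sub>3x\<^sub>3))\<close>.

  For a smooth divergence-free field \<open>w\<close>, project each component orthogonally onto a common finite set
  of scalar products. Integrating \<open>div w\<close> by parts shows that the amplitude vector of each
  wave vector and phase is orthogonal to the wave vector, after a sign change. Such amplitudes
  are spanned by the diagonals of the matrices \<open>G\<close>, so the projection is itself a finite
  combination of velocity modes.
\<close>

section \<open>Iterated integrals\<close>

text \<open>Approximating the components of \<open>w\<close> separately destroys the divergence
  constraint. Orthogonal projection keeps it: its coefficients are integrals of \<open>w\<close>, so
  a linear condition on \<open>w\<close> becomes one on the coefficients, for one wave vector and
  phase at a time. The three components share an index set because this condition couples them. The
  obstacle is wave vectors with zero entries. Some component modes then vanish identically;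
  \<open>nu\<close> records which survive, and the admissible phases of a nonzero wave vector are
  those with a surviving component along an axis not parallel to it. At wave vector zero the
  divergence says nothing and the zero means take over. In x_3 only half a period is available,
  where sines and cosines are not mutually orthogonal; each component therefore keeps one x_3 phase
  throughout. Polynomials on the image of the layer give only cosines in x_3, so functions vanishing
  on the walls need an argument of their own.\<close>

declare add_bit_eq_xor [simp del] power_bit_unfold [simp del]

text \<open>Arithmetic on the index type \<open>3\<close> is modulo 3, so \<open>j\<close>, \<open>j + 1\<close>, \<open>j + 2\<close> are the three indices.\<close>

definition fibre :: "3 \<Rightarrow> (real \<times> real) \<times> real \<Rightarrow> real^3" where
  "fibre j w = (\<chi> i. if i = j then snd w else if i = j + 1 then fst (fst w) else snd (fst w))"

lemma exhaust_3_cyclic: "i = j \<or> i = j + 1 \<or> i = j + (2::3)"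
  using exhaust_3[of i] exhaust_3[of j] by auto

lemma UNIV_3_cyclic: "(UNIV::3 set) = {j, j + 1, j + 2}"
  using exhaust_3_cyclic by auto

lemma fibre_nth [simp]:
  "fibre j w $ j = snd w" "fibre j w $ (j + 1) = fst (fst w)" "fibre j w $ (j + 2) = snd (fst w)"
  by (auto simp: fibre_def)

lemma continuous_fibre: "continuous_on S (fibre j)"
proof -
  have "continuous_on S (\<lambda>w. if i = j then snd w else if i = j + 1 then fst (fst w) else snd (fst w))" for i
    by (cases "i = j"; cases "i = j + 1") (auto intro!: continuous_intros)
  then show ?thesis
    unfolding fibre_def by (intro continuous_on_vec_lambda)
qed

lemma all_3_cyclic: "(\<forall>i::3. P i) \<longleftrightarrow> P j \<and> P (j + 1) \<and> P (j + 2)"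
  using exhaust_3_cyclic[of _ j] by metis

lemma fibre_inverse [simp]: "fibre j ((x $ (j + 1), x $ (j + 2)), x $ j) = x"
  by (simp add: vec_eq_iff all_3_cyclic[of _ j])

lemma fibre_image_cbox:
  "fibre j ` cbox u v = cbox (fibre j u) (fibre j v)"
proof
  show "fibre j ` cbox u v \<subseteq> cbox (fibre j u) (fibre j v)"
    by (cases u, cases v) (auto simp: mem_box_cart all_3_cyclic[of _ j] cbox_Pair_eq)
  show "cbox (fibre j u) (fibre j v) \<subseteq> fibre j ` cbox u v"
  proof
    fix x assume "x \<in> cbox (fibre j u) (fibre j v)"
    then have "((x $ (j + 1), x $ (j + 2)), x $ j) \<in> cbox u v"
      by (cases u; cases v) (auto simp: mem_box_cart all_3_cyclic[of _ j] cbox_Pair_eq)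
    then show "x \<in> fibre j ` cbox u v"
      by (metis fibre_inverse image_eqI)
  qed
qed

lemma prod_3_cyclic: "prod f (UNIV::3 set) = f (j + 1) * f (j + 2) * f j"
  by (subst UNIV_3_cyclic[of j]) (use exhaust_3[of j] in \<open>auto simp: mult_ac\<close>)

lemma measure_fibre_cbox: "measure lborel (fibre j ` cbox u v) = measure lborel (cbox u v)"
proof (cases "cbox u v = {}")
  case False
  then have "cbox (fibre j u) (fibre j v) \<noteq> {}"
    using fibre_image_cbox[of j u v] by auto
  moreover obtain u1 u2 u3 v1 v2 v3 where uv: "u = ((u1, u2), u3)" "v = ((v1, v2), v3)"
    by (metis prod.exhaust)
  moreover have "u1 \<le> v1" "u2 \<le> v2" "u3 \<le> v3"
    using False uv by (auto simp: cbox_Pair_eq)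
  ultimately show ?thesis
    by (simp add: fibre_image_cbox content_cbox_cart prod_3_cyclic[of _ j] content_Pair)
qed auto

text \<open>Fubini after the coordinate permutation \<open>fibre j\<close>, which maps boxes to
  boxes of equal volume. Direction \<open>j\<close> is integrated innermost, ready for the
  fundamental theorem of calculus along that axis.\<close>

lemma integral_fibre:
  fixes f :: "real^3 \<Rightarrow> real"
  assumes "continuous_on (cbox 0 b) f"
  shows "integral (cbox 0 b) f =
    integral (cbox (0, 0) (b $ (j + 1), b $ (j + 2))) (\<lambda>v. integral {0..b $ j} (\<lambda>t. f (fibre j (v, t))))"
proof -
  define h where "h = (\<lambda>x::real^3. ((x $ (j + 1), x $ (j + 2)), x $ j))"
  have fh: "fibre j (h x) = x" and hf: "h (fibre j w) = w" for x w
    by (auto simp: h_def)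
  have him: "h ` cbox u v = cbox (h u) (h v)" for u v
  proof -
    have "cbox u v = fibre j ` cbox (h u) (h v)"
      by (simp add: fibre_image_cbox fh)
    then show ?thesis
      by (simp add: image_image hf)
  qed
  have "(f has_integral integral (cbox 0 b) f) (cbox 0 b)"
    using assms integrable_continuous integrable_integral by blast
  \<comment> \<open>The factor \<open>1 / 1\<close> is the reciprocal of the volume ratio of
    \<open>fibre j\<close>, in the form in which \<open>has_integral_twiddle\<close> delivers
    it.\<close>
  then have "((\<lambda>w. f (fibre j w)) has_integral (1 / 1) *\<^sub>R integral (cbox 0 b) f) (h ` cbox 0 b)"
  proof (rule has_integral_twiddle[rotated -1])
    show "continuous (at x) (fibre j)" for x
      using continuous_fibre[of UNIV j] by (simp add: continuous_on_eq_continuous_at del: split_paired_All)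
    show "measure lborel (fibre j ` cbox u v) = 1 * measure lborel (cbox u v)" for u v
      by (simp add: measure_fibre_cbox)
  qed (use fibre_image_cbox him fh hf in \<open>blast | simp\<close>)+
  then have "integral (cbox 0 b) f = integral (cbox (h 0) (h b)) (\<lambda>w. f (fibre j w))"
    by (simp add: him integral_unique)
  also have "\<dots> = integral (cbox (0,0) (b $ (j + 1), b $ (j + 2))) (\<lambda>v. integral (cbox 0 (b $ j)) (\<lambda>t. f (fibre j (v, t))))"
    unfolding h_def zero_index
  proof (rule integral_prod_continuous)
    have "fibre j ` cbox ((0, 0), 0) ((b $ (j + 1), b $ (j + 2)), b $ j) \<subseteq> cbox 0 b"
      unfolding fibre_image_cbox using fibre_inverse[of j 0] fibre_inverse[of j b] by simp
    then show "continuous_on (cbox ((0, 0), 0) ((b $ (j + 1), b $ (j + 2)), b $ j)) (\<lambda>w. f (fibre j w))"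
      using continuous_on_compose2[OF assms continuous_fibre] by blast
  qed
  finally show ?thesis by simp
qed

lemma integral_prod_cart:
  fixes g :: "3 \<Rightarrow> real \<Rightarrow> real"
  assumes "\<And>j. continuous_on UNIV (g j)"
  shows "integral (cbox 0 b) (\<lambda>x::real^3. \<Prod>j\<in>UNIV. g j (x $ j)) = (\<Prod>j\<in>UNIV. integral {0..b $ j} (g j))"
proof -
  have c: "continuous_on S (\<lambda>x. g i (h x))" if "continuous_on S h" for i h and S :: "'z::topological_space set"
    using continuous_on_compose2[OF assms that] by auto
  have 2: "(1::3) + 1 = 2" "(1::3) + 2 = 3" by auto
  have "integral (cbox 0 b) (\<lambda>x::real^3. \<Prod>j\<in>UNIV. g j (x $ j)) =
      integral (cbox (0, 0) (b $ 2, b $ 3)) (\<lambda>v. g 2 (fst v) * g 3 (snd v) * integral {0..b $ 1} (g 1))"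
    by (subst integral_fibre[where j=1])
       (auto simp: prod_3_cyclic[of _ 1] 2 fibre_nth[where j=1, unfolded 2] intro!: continuous_intros c)
  also have "\<dots> = integral (cbox (0, 0) (b $ 2, b $ 3)) (\<lambda>v. g 2 (fst v) * g 3 (snd v)) * integral {0..b $ 1} (g 1)"
    by simp
  also have "integral (cbox (0, 0) (b $ 2, b $ 3)) (\<lambda>v. g 2 (fst v) * g 3 (snd v)) =
      integral {0..b $ 2} (g 2) * integral {0..b $ 3} (g 3)"
    by (subst integral_prod_continuous) (auto intro!: continuous_intros c)
  finally show ?thesis by (simp add: prod_3_cyclic[of _ 1] 2)
qed

section \<open>Products of sines and cosines\<close>

lemma trig_0 [simp]: "trig 0 p x = of_bool (p = 0)"
  by (cases p) (auto simp: trig_def)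

text \<open>All four product-to-sum formulas at once. Since subtraction of naturals truncates,
  \<open>m - n + (n - m)\<close> is the distance of \<open>m\<close> and \<open>n\<close>; the
  second sign accounts for the oddness of sine when this distance is the negative of the difference
  in the formula.\<close>

lemma trig_mult:
  "trig m p x * trig n q x =
     (if p = 1 \<and> q = 1 then -1 else 1) / 2 * trig (m + n) (p + q) x +
     (if p = q \<or> (p = 1 \<longleftrightarrow> n \<le> m) then 1 else -1) / 2 * trig (m - n + (n - m)) (p + q) x"
proof (cases "n \<le> m")
  case True
  then have "real (m - n + (n - m)) * x = real m * x - real n * x" "real (m + n) * x = real m * x + real n * x"
    by (auto simp: algebra_simps of_nat_diff)
  with True show ?thesis
    by (cases p; cases q) (simp_all add: trig_def cos_add sin_add cos_diff sin_diff field_simps)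
next
  case False
  then have "real (m - n + (n - m)) * x = real n * x - real m * x" "real (m + n) * x = real m * x + real n * x"
    by (auto simp: algebra_simps of_nat_diff)
  with False show ?thesis
    by (cases p; cases q) (simp_all add: trig_def cos_add sin_add cos_diff sin_diff field_simps)
qed

lemma trig_has_real_derivative [derivative_intros]:
  assumes "(f has_real_derivative f') (at x within S)"
  shows "((\<lambda>x. trig m p (f x)) has_real_derivative
    (-1) ^ of_bit (p + 1) * real m * trig m (p + 1) (f x) * f') (at x within S)"
  using assms by (cases p) (auto simp: trig_def intro!: derivative_eq_intros)

lemma continuous_on_trig [continuous_intros]:
  fixes S :: "'a::t2_space set"
  shows "continuous_on S f \<Longrightarrow> continuous_on S (\<lambda>x. trig m p (f x))"
  by (cases p) (simp_all add: trig_def continuous_on_cos continuous_on_sin continuous_on_mult_left)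

lemma integral_trig:
  assumes "m > 0" "\<kappa> > 0" "b \<ge> 0"
  shows "integral {0..b} (\<lambda>x. trig m p (\<kappa> * x)) =
    (-1) ^ of_bit p * (trig m (p + 1) (\<kappa> * b) - trig m (p + 1) 0) / (real m * \<kappa>)"
proof -
  have "((\<lambda>x. trig m p (\<kappa> * x)) has_integral
     ((-1) ^ of_bit p * trig m (p + 1) (\<kappa> * b) / (real m * \<kappa>)
      - (-1) ^ of_bit p * trig m (p + 1) (\<kappa> * 0) / (real m * \<kappa>))) {0..b}"
    using assms
    by (intro fundamental_theorem_of_calculus)
       (cases p; auto intro!: derivative_eq_intros simp: has_real_derivative_iff_has_vector_derivative[symmetric])+
  then show ?thesis
    by (simp add: integral_unique right_diff_distrib diff_divide_distrib)
qed

lemma integral_trig_period: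
  assumes "\<kappa> > 0"
  shows "integral {0..2 * pi / \<kappa>} (\<lambda>x. trig m p (\<kappa> * x)) = of_bool (m = 0 \<and> p = 0) * (2 * pi / \<kappa>)"
proof (cases "m = 0")
  case False
  have "trig m (p + 1) (\<kappa> * (2 * pi / \<kappa>)) = trig m (p + 1) 0"
    using assms sin_npi[of "2 * m"] cos_npi[of "2 * m"]
    by (cases p) (auto simp: trig_def mult_ac)
  then show ?thesis
    using False assms by (simp add: integral_trig)
qed (use assms in simp)

text \<open>Restricted to cosines: over half a period a sine with odd \<open>m\<close> has nonzero
  integral. This is why orthogonality in x_3 is only available for equal phases.\<close>

lemma integral_trig_half_period:
  assumes "\<kappa> > 0"
  shows "integral {0..pi / \<kappa>} (\<lambda>x. trig m 0 (\<kappa> * x)) = of_bool (m = 0) * (pi / \<kappa>)"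
proof (cases "m = 0")
  case False
  have "trig m 1 (\<kappa> * (pi / \<kappa>)) = 0" "trig m 1 0 = 0"
    using assms by (auto simp: trig_def)
  then show ?thesis
    using False assms by (simp add: integral_trig)
qed (use assms in simp)

text \<open>The hypotheses are what the product-to-sum formulas leave to compute, so the full and
  the half period share one argument. The factor
  \<open>real (iota m) ^ of_bit p / 2 ^ iota m\<close> is the mean square of
  \<open>trig m p\<close>: 1 for the constant, 1/2 for positive \<open>m\<close>, 0 for the sine
  with \<open>m = 0\<close>.\<close>

lemma trig_orthogonality:
  assumes "integral {0..b} (\<lambda>x. trig (m + n) (p + q) (\<kappa> * x)) = of_bool (m + n = 0 \<and> p + q = 0) * b"
    and "integral {0..b} (\<lambda>x. trig (m - n + (n - m)) (p + q) (\<kappa> * x)) = of_bool (m = n \<and> p + q = 0) * b"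
  shows "integral {0..b} (\<lambda>x. trig m p (\<kappa> * x) * trig n q (\<kappa> * x)) =
    of_bool (m = n \<and> p = q) * real (iota m) ^ of_bit p / 2 ^ iota m * b"
proof -
  have *: "(\<lambda>x. c * trig i r (\<kappa> * x)) integrable_on {0..b}" for c i r
    by (intro integrable_continuous_real continuous_intros)
  show ?thesis
    unfolding trig_mult integral_add[OF * *] integral_mult_right assms
    by (cases p; cases q) (auto simp: iota_def)
qed

lemma trig_orthogonality_period:
  assumes "\<kappa> > 0"
  shows "integral {0..2 * pi / \<kappa>} (\<lambda>x. trig m p (\<kappa> * x) * trig n q (\<kappa> * x)) =
    of_bool (m = n \<and> p = q) * real (iota m) ^ of_bit p / 2 ^ iota m * (2 * pi / \<kappa>)"
  using assms by (intro trig_orthogonality) (auto simp: integral_trig_period)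

lemma trig_orthogonality_half_period:
  assumes "\<kappa> > 0"
  shows "integral {0..pi / \<kappa>} (\<lambda>x. trig m p (\<kappa> * x) * trig n p (\<kappa> * x)) =
    of_bool (m = n) * real (iota m) ^ of_bit p / 2 ^ iota m * (pi / \<kappa>)"
proof -
  have "p + p = 0" by (cases p) auto
  then show ?thesis
    using assms by (subst trig_orthogonality) (auto simp: integral_trig_half_period)
qed

lemma trig_shift_period:
  "\<kappa> > 0 \<Longrightarrow> trig m p (\<kappa> * (t + 2 * pi / \<kappa>)) = trig m p (\<kappa> * t)"
  using sin_npi[of "2 * m"] cos_npi[of "2 * m"]
  by (cases p) (simp_all add: trig_def distrib_left sin_add cos_add mult_ac)

definition trig_prod :: "real^3 \<Rightarrow> nat^3 \<Rightarrow> (3 \<Rightarrow> bit) \<Rightarrow> real^3 \<Rightarrow> real" where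
  "trig_prod k m q x = (\<Prod>j\<in>UNIV. trig (m$j) (q j) (k$j * x$j))"

lemma prod_3: "prod f (UNIV::3 set) = f 1 * f 2 * f 3"
  unfolding UNIV_3 by (simp add: ac_simps)

lemma continuous_on_trig_prod [continuous_intros]: "continuous_on S (trig_prod k m q)"
  unfolding trig_prod_def by (intro continuous_intros)

lemma trig_prod_has_derivative:
  "(trig_prod k m q has_derivative
     (\<lambda>h. \<Sum>j\<in>UNIV. h$j * ((-1) ^ of_bit (q j + 1) * (k$j * real (m$j)) * trig_prod k m (q(j := q j + 1)) x)))
   (at x within S)"
proof -
  have 1: "((\<lambda>x. trig (m$j) (q j) (k$j * x$j)) has_derivative
      (\<lambda>h. h$j * ((-1) ^ of_bit (q j + 1) * (k$j * real (m$j)) * trig (m$j) (q j + 1) (k$j * x$j)))) (at x within S)" for j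
  proof -
    have "((\<lambda>t. trig (m$j) (q j) t) has_real_derivative
        (-1) ^ of_bit (q j + 1) * real (m$j) * trig (m$j) (q j + 1) (k$j * x$j) * 1) (at (k$j * x$j))"
      by (intro derivative_intros)
    then have "((\<lambda>t. trig (m$j) (q j) t) has_derivative
        (\<lambda>h. (-1) ^ of_bit (q j + 1) * real (m$j) * trig (m$j) (q j + 1) (k$j * x$j) * h)) (at (k$j * x$j))"
      by (simp only: has_field_derivative_def mult_1_right)
    moreover have "((\<lambda>x. k$j * x$j) has_derivative (\<lambda>h. k$j * h$j)) (at x within S)"
      by (intro derivative_intros bounded_linear.has_derivative[OF bounded_linear_vec_nth] has_derivative_ident)
    ultimately show ?thesis
      by (rule has_derivative_eq_rhs[OF has_derivative_compose[rotated]]) (auto simp: mult_ac)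
  qed
  have 2: "trig (m$j) (q j + 1) (k$j * x$j) * (\<Prod>i\<in>UNIV - {j}. trig (m$i) (q i) (k$i * x$i)) =
      trig_prod k m (q(j := q j + 1)) x" for j
    unfolding trig_prod_def
    by (subst prod.remove[of _ j]) (auto intro!: prod.cong)
  have 3: "trig_prod k m q = (\<lambda>x. \<Prod>j\<in>UNIV. trig (m$j) (q j) (k$j * x$j))"
    by (simp add: trig_prod_def fun_eq_iff)
  show ?thesis
    by (subst 3, rule has_derivative_eq_rhs[OF has_derivative_prod[OF 1]])
       (auto simp: fun_eq_iff 2[symmetric] mult_ac)
qed

locale layer =
  fixes k :: "real^3"
  assumes k1_pos: "0 < k$1" and k2_pos: "0 < k$2" and k3_eq: "k$3 = inverse (k$1 * k$2)"
begin

lemma k_pos: "0 < k$j"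
  using exhaust_3[of j] k1_pos k2_pos k3_eq by auto

abbreviation corner :: "real^3" where
  "corner \<equiv> vector [2 * pi / k$1, 2 * pi / k$2, pi / k$3]"

lemma corner_pos: "0 < corner $ j"
  using exhaust_3[of j] k_pos by (auto simp: vector_def)

lemma Omega_integral_eq:
  assumes "continuous_on (Omega k) g"
  shows "Omega_integral k g = integral (cbox 0 corner) g" "integrable (lebesgue_on (Omega k)) g"
  using assms continuous_imp_integrable[of 0 corner g]
  by (auto simp: Omega_integral_def Omega_def lebesgue_integral_eq_integral)

lemma trig_prod_orthogonality:
  assumes "q 3 = q' 3"
  shows "Omega_integral k (\<lambda>x. trig_prod k m q x * trig_prod k n q' x) =
    of_bool (m = n \<and> q = q') * (\<Prod>j\<in>UNIV. real (iota (m$j)) ^ of_bit (q j)) * (4 * pi ^ 3) / (\<Prod>j\<in>UNIV. 2 ^ iota (m$j))"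
proof -
  have "Omega_integral k (\<lambda>x. trig_prod k m q x * trig_prod k n q' x) =
      integral (cbox 0 corner) (\<lambda>x. \<Prod>j\<in>UNIV. trig (m$j) (q j) (k$j * x$j) * trig (n$j) (q' j) (k$j * x$j))"
    by (subst Omega_integral_eq) (auto simp: trig_prod_def prod.distrib intro!: continuous_intros)
  also have "\<dots> = (\<Prod>j\<in>UNIV. integral {0..corner $ j} (\<lambda>t. trig (m$j) (q j) (k$j * t) * trig (n$j) (q' j) (k$j * t)))"
    by (rule integral_prod_cart) (auto intro!: continuous_intros)
  also have "\<dots> = (\<Prod>j\<in>UNIV. of_bool (m$j = n$j \<and> q j = q' j) * real (iota (m$j)) ^ of_bit (q j) / 2 ^ iota (m$j) * corner $ j)"
    using assms trig_orthogonality_period[OF k_pos] trig_orthogonality_half_period[OF k_pos]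
    by (auto simp: prod_3)
  also have "\<dots> = (\<Prod>j\<in>UNIV. of_bool (m$j = n$j \<and> q j = q' j)) * (\<Prod>j\<in>UNIV. real (iota (m$j)) ^ of_bit (q j))
      * (\<Prod>j\<in>UNIV. corner $ j) / (\<Prod>j\<in>UNIV. 2 ^ iota (m$j))"
    by (simp add: prod.distrib prod_dividef)
  \<comment> \<open>The volume of the box; the wave numbers drop out because their product is
    1.\<close>
  also have "(\<Prod>j\<in>UNIV. corner $ j) = 4 * pi ^ 3"
    using k_pos[of 1] k_pos[of 2] k3_eq by (simp add: prod_3 power3_eq_cube field_simps)
  also have "(\<Prod>j\<in>UNIV. of_bool (m$j = n$j \<and> q j = q' j)) = (of_bool (m = n \<and> q = q') :: real)"
    by (auto simp: vec_eq_iff fun_eq_iff)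
  finally show ?thesis by simp
qed

end

text \<open>A partial derivative flips phases and rescales coefficients, so sums of this form are
  closed under differentiation; this class is the coinduction invariant. Coefficients in an
  arbitrary normed space let one lemma serve scalar and vector modes.\<close>

lemma smooth_on_sum_trig_prod:
  fixes b :: "3 \<Rightarrow> 'b::real_normed_vector"
  shows "smooth_on S (\<lambda>x. \<Sum>i\<in>UNIV. trig_prod k m (q i) x *\<^sub>R b i)"
proof -
  define P where "P = (\<lambda>u. \<exists>q (b :: 3 \<Rightarrow> 'b). u = (\<lambda>x. \<Sum>i\<in>UNIV. trig_prod k m (q i) x *\<^sub>R b i))"
  have "P (\<lambda>x. \<Sum>i\<in>UNIV. trig_prod k m (q i) x *\<^sub>R b i)"
    unfolding P_def by blast
  then show ?thesis
  proof (coinduct rule: smooth_on.coinduct)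
    case (smooth_on u)
    then obtain q and b :: "3 \<Rightarrow> 'b" where u: "u = (\<lambda>x. \<Sum>i\<in>UNIV. trig_prod k m (q i) x *\<^sub>R b i)"
      unfolding P_def by blast
    define D where "D = (\<lambda>j x. \<Sum>i\<in>UNIV. trig_prod k m ((q i)(j := q i j + 1)) x *\<^sub>R
      (((-1) ^ of_bit (q i j + 1) * (k$j * real (m$j))) *\<^sub>R b i))"
    have "(u has_derivative (\<lambda>h. \<Sum>j\<in>UNIV. h$j *\<^sub>R D j x)) (at x within S)" for x
    proof -
      have "(u has_derivative (\<lambda>h. \<Sum>i\<in>UNIV. (\<Sum>j\<in>UNIV. h$j * ((-1) ^ of_bit (q i j + 1) * (k$j * real (m$j))
          * trig_prod k m ((q i)(j := q i j + 1)) x)) *\<^sub>R b i)) (at x within S)"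
        unfolding u by (intro has_derivative_sum has_derivative_scaleR_left trig_prod_has_derivative)
      also have "(\<lambda>h. \<Sum>i\<in>UNIV. (\<Sum>j\<in>UNIV. h$j * ((-1) ^ of_bit (q i j + 1) * (k$j * real (m$j))
          * trig_prod k m ((q i)(j := q i j + 1)) x)) *\<^sub>R b i) = (\<lambda>h. \<Sum>j\<in>UNIV. h$j *\<^sub>R D j x)"
        unfolding D_def scaleR_sum_left scaleR_sum_right
        by (subst sum.swap) (auto simp: fun_eq_iff mult_ac intro!: sum.cong)
      finally show ?thesis .
    qed
    moreover have "P (D j)" for j
      unfolding D_def P_def
      by (intro exI[of _ "\<lambda>i. (q i)(j := q i j + 1)"]
        exI[of _ "\<lambda>i. ((-1) ^ of_bit (q i j + 1) * (k$j * real (m$j))) *\<^sub>R b i"]) (rule refl)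
    ultimately show ?case
      by blast
  qed
qed

section \<open>Uniform approximation and integration by parts\<close>

lemma smooth_on_imp_continuous_on: "smooth_on S u \<Longrightarrow> continuous_on S u"
  by (erule smooth_on.cases) (use has_derivative_continuous continuous_on_eq_continuous_within in blast)

text \<open>The parameter \<open>r\<close> is the common phase in \<open>x\<^sub>3\<close>: cosines for 0, sines for 1.\<close>

inductive trig_poly :: "real^3 \<Rightarrow> bit \<Rightarrow> (real^3 \<Rightarrow> real) \<Rightarrow> bool" for k where
  mode: "q 3 = r \<Longrightarrow> trig_poly k r (\<lambda>x. c * trig_prod k m q x)"
| add: "trig_poly k r f \<Longrightarrow> trig_poly k r g \<Longrightarrow> trig_poly k r (\<lambda>x. f x + g x)"

lemma trig_poly_scale: "trig_poly k r f \<Longrightarrow> trig_poly k r (\<lambda>x. c * f x)"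
proof (induction rule: trig_poly.induct)
  case (mode q r c' m)
  then show ?case
    using trig_poly.mode[of q r k "c * c'" m] by (simp add: mult.assoc)
next
  case (add r f g)
  then show ?case
    using trig_poly.add by (simp add: distrib_left)
qed

lemma trig_poly_const: "trig_poly k 0 (\<lambda>x. c)"
  using trig_poly.mode[of "\<lambda>_. 0" 0 k c 0] by (simp add: trig_prod_def)

text \<open>By the product-to-sum formulas, a factor in direction \<open>j\<close> alters only the
  \<open>j\<close>-th wave number and phase of a product. Hence the x_3 phase changes by
  \<open>p\<close> if \<open>j = 3\<close> and not at all otherwise.\<close>

lemma trig_poly_mult_trig:
  assumes "trig_poly k r f"
  shows "trig_poly k (r + (if j = 3 then p else 0)) (\<lambda>x. trig n p (k$j * x$j) * f x)"
  using assms
proof (induction rule: trig_poly.induct)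
  case (mode q r c m)
  define q' where "q' = q(j := p + q j)"
  define m' where "m' = (\<lambda>l. \<chi> i. if i = j then l else m$i)"
  have m': "trig_prod k (m' l) q' x = trig l (p + q j) (k$j * x$j) * (\<Prod>i\<in>UNIV - {j}. trig (m$i) (q i) (k$i * x$i))" for l x
    unfolding trig_prod_def
    by (subst prod.remove[of _ j]) (auto simp: m'_def q'_def intro!: prod.cong)
  have q: "trig_prod k m q x = trig (m$j) (q j) (k$j * x$j) * (\<Prod>i\<in>UNIV - {j}. trig (m$i) (q i) (k$i * x$i))" for x
    unfolding trig_prod_def by (subst prod.remove[of _ j]) auto
  obtain A B l l' where "\<And>t. trig n p t * trig (m$j) (q j) t = A * trig l (p + q j) t + B * trig l' (p + q j) t"
    using trig_mult by metis
  then have "trig n p (k$j * x$j) * (c * trig_prod k m q x) =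
      (c * A) * trig_prod k (m' l) q' x + (c * B) * trig_prod k (m' l') q' x" for x
    unfolding q m' by (simp add: algebra_simps flip: mult.assoc[of "trig n p t" for t])
  moreover have "q' 3 = r + (if j = 3 then p else 0)"
    using mode by (auto simp: q'_def add.commute)
  ultimately show ?case
    by (simp only:) (intro trig_poly.intros)
next
  case (add r f g)
  then show ?case
    using trig_poly.add by (simp add: distrib_left)
qed

lemma trig_poly_mult:
  assumes "trig_poly k r f" "trig_poly k s g"
  shows "trig_poly k (r + s) (\<lambda>x. f x * g x)"
  using assms
proof (induction rule: trig_poly.induct)
  case (mode q r c m)
  have "trig_poly k (r + s) (\<lambda>x. c * (trig (m$1) (q 1) (k$1 * x$1) * (trig (m$2) (q 2) (k$2 * x$2) *
     (trig (m$3) (q 3) (k$3 * x$3) * g x))))"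
    using trig_poly_mult_trig[OF mode(2), of 3 "q 3" "m$3"] mode(1)
    by (intro trig_poly_scale trig_poly_mult_trig[where j=1, simplified] trig_poly_mult_trig[where j=2, simplified])
       (simp add: add.commute)
  then show ?case
    by (simp add: trig_prod_def prod_3 mult_ac)
next
  case (add r f g)
  then show ?case
    using trig_poly.add by (simp add: distrib_right)
qed

lemma continuous_on_trig_poly: "trig_poly k r f \<Longrightarrow> continuous_on S f"
  by (induction rule: trig_poly.induct) (auto intro!: continuous_intros)

text \<open>The interval has the length of one period, so two of its points with the same image on
  the circle differ by -1, 0 or 1 periods.\<close>

lemma circle_cases:
  assumes "\<kappa> > 0" "s \<in> {0..2 * pi / \<kappa>}" "t \<in> {0..2 * pi / \<kappa>}"
    and "cos (\<kappa> * s) = cos (\<kappa> * t)" "sin (\<kappa> * s) = sin (\<kappa> * t)"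
  shows "s = t \<or> t = s + 2 * pi / \<kappa> \<or> s = t + 2 * pi / \<kappa>"
proof -
  obtain n :: int where n: "\<kappa> * s = \<kappa> * t + 2 * pi * n"
    using assms(4,5) sin_cos_eq_iff[of "\<kappa> * s" "\<kappa> * t"] by auto
  then have s: "s = t + real_of_int n * (2 * pi / \<kappa>)"
    using assms(1) by (simp add: field_simps)
  define P where "P = 2 * pi / \<kappa>"
  have P: "P > 0" using assms(1) by (simp add: P_def)
  have "real_of_int n * P \<le> 1 * P" "-1 * P \<le> real_of_int n * P"
    using assms(2,3) s by (auto simp: P_def)
  then have "real_of_int n \<le> 1" "-1 \<le> real_of_int n"
    using P mult_right_le_imp_le by blast+
  then have "n = -1 \<or> n = 0 \<or> n = 1" by linarith
  then show ?thesis using s by auto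
qed

section \<open>Density of trigonometric products in the continuous periodic functions\<close>

context layer begin

text \<open>A periodic direction needs both circle coordinates, whereas in x_3 the cosine alone is
  injective between the walls. Leaving out \<open>sin (k$3 * x$3)\<close> makes every polynomial in
  these coordinates a sum of cosines in x_3.\<close>

definition torus :: "real^3 \<Rightarrow> ((real \<times> real) \<times> (real \<times> real)) \<times> real" where
  "torus x = (((cos (k$1 * x$1), sin (k$1 * x$1)), (cos (k$2 * x$2), sin (k$2 * x$2))), cos (k$3 * x$3))"

lemma trig_poly_single:
  "r = (if j = 3 then p else 0) \<Longrightarrow> trig_poly k r (\<lambda>x. trig n p (k$j * x$j))"
  using trig_poly_mult_trig[OF trig_poly_const[of k 1], of j p n] by simp

lemma trig_poly_torus:
  assumes "real_polynomial_function f"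
  shows "trig_poly k 0 (\<lambda>x. f (torus x))"
  using assms
proof (induction rule: real_polynomial_function.induct)
  case (linear f)
  interpret bounded_linear f by fact
  define c1 where "c1 = f (((1, 0), (0, 0)), 0)"
  define c2 where "c2 = f (((0, 1), (0, 0)), 0)"
  define c3 where "c3 = f (((0, 0), (1, 0)), 0)"
  define c4 where "c4 = f (((0, 0), (0, 1)), 0)"
  define c5 where "c5 = f (((0, 0), (0, 0)), 1)"
  have f: "f (((a, b), (c, d)), e) = c1 * a + (c2 * b + (c3 * c + (c4 * d + c5 * e)))" for a b c d e
  proof -
    have "(((a, b), (c, d)), e) = a *\<^sub>R (((1, 0), (0, 0)), 0) + (b *\<^sub>R (((0, 1), (0, 0)), 0) +
       (c *\<^sub>R (((0, 0), (1, 0)), 0) + (d *\<^sub>R (((0, 0), (0, 1)), 0) + e *\<^sub>R (((0, 0), (0, 0)), 1))))"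
      by simp
    then show ?thesis
      by (simp only: add scaleR c1_def c2_def c3_def c4_def c5_def) (simp add: mult.commute)
  qed
  have cs: "cos t = trig 1 0 t" "sin t = trig 1 1 t" for t
    by (auto simp: trig_def)
  show ?case
    unfolding torus_def f cs
    by (intro trig_poly.add trig_poly_scale trig_poly_single) auto
next
  case (mult f g)
  then show ?case using trig_poly_mult[of k 0 "\<lambda>x. f (torus x)" 0] by simp
qed (auto intro: trig_poly_const trig_poly.add)

lemma continuous_on_torus: "continuous_on S torus"
  unfolding torus_def by (intro continuous_intros)

lemma Omega_mem: "x \<in> Omega k \<longleftrightarrow>
  x$1 \<in> {0..2 * pi / k$1} \<and> x$2 \<in> {0..2 * pi / k$2} \<and> x$3 \<in> {0..pi / k$3}"
  by (auto simp: Omega_def mem_box_cart forall_3)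

lemma Omega_subset_slab: "Omega k \<subseteq> slab k"
  by (auto simp: Omega_mem slab_def)

lemma periodic_torus_eq:
  assumes per: "horizontally_periodic k g" and x: "x \<in> Omega k" and y: "y \<in> Omega k"
    and eq: "torus x = torus y"
  shows "g x = g y"
proof -
  have c1: "x$1 = y$1 \<or> y$1 = x$1 + 2 * pi / k$1 \<or> x$1 = y$1 + 2 * pi / k$1"
    using x y eq by (intro circle_cases k_pos) (auto simp: Omega_mem torus_def)
  have c2: "x$2 = y$2 \<or> y$2 = x$2 + 2 * pi / k$2 \<or> x$2 = y$2 + 2 * pi / k$2"
    using x y eq by (intro circle_cases k_pos) (auto simp: Omega_mem torus_def)
  have "0 \<le> k$3 * t \<and> k$3 * t \<le> pi" if "t \<in> {0..pi / k$3}" for t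
    using that k_pos[of 3] by (simp add: pos_le_divide_eq mult.commute)
  moreover have "x$3 \<in> {0..pi / k$3}" "y$3 \<in> {0..pi / k$3}"
    using x y unfolding Omega_mem by blast+
  moreover have "cos (k$3 * x$3) = cos (k$3 * y$3)"
    using eq by (simp add: torus_def)
  ultimately have "k$3 * x$3 = k$3 * y$3"
    using cos_inj_pi by blast
  then have c3: "x$3 = y$3" using k_pos[of 3] by simp
  \<comment> \<open>An intermediate point with the first coordinate of \<open>x\<close> and the
    others of \<open>y\<close>, so that each comparison shifts in a single direction.\<close>
  define z where "z = (\<chi> i. if i = 1 then x$1 else y$i)"
  have z: "z \<in> slab k" "x \<in> slab k" "y \<in> slab k"
    using x y by (auto simp: z_def slab_def Omega_mem)
  have "z = y \<or> y = z + axis 1 (2 * pi / k$1) \<or> z = y + axis 1 (2 * pi / k$1)"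
    using c1 by (auto simp: vec_eq_iff forall_3 z_def axis_def)
  then have "g z = g y"
    using per z unfolding horizontally_periodic_def by metis
  moreover have "z = x \<or> x = z + axis 2 (2 * pi / k$2) \<or> z = x + axis 2 (2 * pi / k$2)"
    using c2 c3 by (auto simp: vec_eq_iff forall_3 z_def axis_def)
  then have "g z = g x"
    using per z unfolding horizontally_periodic_def by metis
  ultimately show ?thesis by simp
qed

lemma trig_poly_approx:
  assumes cont: "continuous_on (slab k) g" and per: "horizontally_periodic k g" and "e > 0"
  shows "\<exists>h. trig_poly k 0 h \<and> (\<forall>x\<in>Omega k. \<bar>g x - h x\<bar> < e)"
proof -
  have comp: "compact (Omega k)" by (simp add: Omega_def)
  have contO: "continuous_on (Omega k) g"
    using cont Omega_subset_slab continuous_on_subset by blast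
  define G where "G = (\<lambda>z. g (SOME x. x \<in> Omega k \<and> torus x = z))"
  have G: "G (torus x) = g x" if "x \<in> Omega k" for x
  proof -
    have "(SOME y. y \<in> Omega k \<and> torus y = torus x) \<in> Omega k \<and>
        torus (SOME y. y \<in> Omega k \<and> torus y = torus x) = torus x"
      by (rule someI[of "\<lambda>y. y \<in> Omega k \<and> torus y = torus x" x]) (use that in auto)
    then show ?thesis
      unfolding G_def using periodic_torus_eq[OF per _ that] by blast
  qed
  \<comment> \<open>Continuity of \<open>G\<close>: preimages of closed sets are images under
    \<open>torus\<close> of compact sets, hence closed.\<close>
  have "closed (torus ` Omega k \<inter> G -` C)" if "closed C" for C
  proof -
    have "torus ` Omega k \<inter> G -` C = torus ` (Omega k \<inter> g -` C)"
      using G by auto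
    moreover have "compact (Omega k \<inter> g -` C)"
      using continuous_closed_preimage[OF contO _ that] comp
      by (metis compact_Int_closed compact_imp_closed inf.left_idem)
    ultimately show ?thesis
      by (simp add: compact_continuous_image compact_imp_closed continuous_on_torus)
  qed
  moreover have compT: "compact (torus ` Omega k)"
    by (simp add: comp compact_continuous_image continuous_on_torus)
  ultimately have "continuous_on (torus ` Omega k) G"
    by (subst continuous_on_closed_vimage) (auto simp: compact_imp_closed Int_commute)
  then obtain f where "real_polynomial_function f" "\<And>z. z \<in> torus ` Omega k \<Longrightarrow> \<bar>G z - f z\<bar> < e"
    using Stone_Weierstrass_real_polynomial_function[OF compT _ \<open>e > 0\<close>] by metis
  then have "trig_poly k 0 (\<lambda>x. f (torus x)) \<and> (\<forall>x\<in>Omega k. \<bar>g x - f (torus x)\<bar> < e)"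
    using trig_poly_torus G by (metis image_eqI)
  then show ?thesis by blast
qed

text \<open>
  A function vanishing on the walls is divided by \<open>sin (k\<^sub>3 x\<^sub>3)\<close>, regularised to avoid the zeros
  of the denominator, and the quotient is approximated by cosines in \<open>x\<^sub>3\<close>.
\<close>

lemma trig_poly_approx_walls:
  assumes cont: "continuous_on (slab k) g" and per: "horizontally_periodic k g"
    and walls: "\<And>x. x \<in> walls k \<Longrightarrow> g x = 0" and "e > 0"
  shows "\<exists>h. trig_poly k 1 h \<and> (\<forall>x\<in>Omega k. \<bar>g x - h x\<bar> < e)"
proof -
  define s where "s = (\<lambda>x::real^3. sin (k$3 * x$3))"
  have s_cont: "continuous_on S s" for S
    unfolding s_def by (intro continuous_intros)
  have comp: "compact (Omega k)" by (simp add: Omega_def)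
  have contO: "continuous_on (Omega k) g"
    using cont Omega_subset_slab continuous_on_subset by blast
  obtain B where B: "B > 0" "\<And>x. x \<in> Omega k \<Longrightarrow> \<bar>g x\<bar> \<le> B"
    using compact_continuous_image[OF contO comp] compact_imp_bounded[of "g ` Omega k"]
    unfolding bounded_pos by auto
  \<comment> \<open>On \<open>K\<close> the sine is bounded away from zero by compactness, since
    \<open>g\<close> vanishes on the walls. Outside \<open>K\<close> the function \<open>g\<close>
    is itself below the tolerance, so the regularisation error needs no bound on the sine.\<close>
  define K where "K = {x \<in> Omega k. e / 2 \<le> \<bar>g x\<bar>}"
  have compK: "compact K"
  proof -
    have "K = Omega k \<inter> (\<lambda>x. \<bar>g x\<bar>) -` {e / 2..}" by (auto simp: K_def)
    then show ?thesis
      using continuous_closed_preimage[of "Omega k" "\<lambda>x. \<bar>g x\<bar>" "{e / 2..}"] contO comp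
      by (metis closed_atLeast compact_Int_closed compact_imp_closed continuous_on_rabs inf.left_idem)
  qed
  have s_K: "(s x)\<^sup>2 > 0" if "x \<in> K" for x
  proof -
    have "x$3 \<noteq> 0" "x$3 \<noteq> pi / k$3"
      using that walls[of x] \<open>e > 0\<close> by (auto simp: K_def walls_def)
    then have "0 < k$3 * x$3" "k$3 * x$3 < pi"
      using that k_pos[of 3] by (auto simp: K_def Omega_mem field_simps)
    then show ?thesis
      unfolding s_def using sin_gt_zero by fastforce
  qed
  obtain c where c: "c > 0" "\<And>x. x \<in> K \<Longrightarrow> c \<le> (s x)\<^sup>2"
  proof (cases "K = {}")
    case True
    then show ?thesis using that[of 1] by auto
  next
    case False
    obtain x where "x \<in> K" "\<And>y. y \<in> K \<Longrightarrow> (s x)\<^sup>2 \<le> (s y)\<^sup>2"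
      using continuous_attains_inf[OF compK False, of "\<lambda>x. (s x)\<^sup>2"] s_cont
      by (auto intro!: continuous_intros)
    then show ?thesis using that s_K by blast
  qed
  \<comment> \<open>Chosen so that the bound \<open>B * (d / c)\<close> for the regularisation error
    on \<open>K\<close> is exactly \<open>e / 2\<close>.\<close>
  define d where "d = c * e / (2 * B)"
  have d: "d > 0" using c B \<open>e > 0\<close> by (simp add: d_def)
  have den: "(s x)\<^sup>2 + d > 0" for x
    using d by (simp add: add_nonneg_pos)
  define h where "h = (\<lambda>x. g x * s x / ((s x)\<^sup>2 + d))"
  have "continuous_on (slab k) h"
    unfolding h_def using den by (intro continuous_intros cont s_cont) (metis less_irrefl)
  moreover have "horizontally_periodic k h"
    using per by (auto simp: horizontally_periodic_def h_def s_def axis_def)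
  ultimately obtain Q where Q: "trig_poly k 0 Q" "\<And>x. x \<in> Omega k \<Longrightarrow> \<bar>h x - Q x\<bar> < e / 2"
    using trig_poly_approx[of h "e / 2"] \<open>e > 0\<close> by auto
  have "trig_poly k 1 (\<lambda>x. s x * Q x)"
    using trig_poly_mult_trig[OF Q(1), of 3 1 1] by (simp add: trig_def s_def)
  moreover have "\<bar>g x - s x * Q x\<bar> < e" if x: "x \<in> Omega k" for x
  proof -
    have "g x - s x * Q x = g x * (d / ((s x)\<^sup>2 + d)) + s x * (h x - Q x)"
    proof -
      have "d / ((s x)\<^sup>2 + d) + (s x)\<^sup>2 / ((s x)\<^sup>2 + d) = 1"
        using den[of x] by (simp add: add_divide_distrib[symmetric])
      then have "g x * (d / ((s x)\<^sup>2 + d)) + g x * ((s x)\<^sup>2 / ((s x)\<^sup>2 + d)) = g x"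
        by (metis distrib_left mult.right_neutral)
      moreover have "g x * ((s x)\<^sup>2 / ((s x)\<^sup>2 + d)) = s x * h x"
        by (simp add: h_def power2_eq_square)
      ultimately show ?thesis by (simp add: right_diff_distrib)
    qed
    moreover have "\<bar>s x * (h x - Q x)\<bar> < e / 2"
    proof -
      have "\<bar>s x * (h x - Q x)\<bar> \<le> 1 * \<bar>h x - Q x\<bar>"
        unfolding abs_mult s_def by (intro mult_right_mono) auto
      then show ?thesis using Q(2)[OF x] by simp
    qed
    moreover have "\<bar>g x * (d / ((s x)\<^sup>2 + d))\<bar> \<le> e / 2"
    proof (cases "x \<in> K")
      case True
      have "\<bar>g x * (d / ((s x)\<^sup>2 + d))\<bar> = \<bar>g x\<bar> * (d / ((s x)\<^sup>2 + d))"
        using d den[of x] by (simp add: abs_mult)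
      also have "\<dots> \<le> B * (d / c)"
        using c(2)[OF True] c(1) d den[of x] B(2)[OF x] by (intro mult_mono frac_le) auto
      also have "\<dots> = e / 2"
        using c B by (simp add: d_def)
      finally show ?thesis .
    next
      case False
      have "\<bar>g x * (d / ((s x)\<^sup>2 + d))\<bar> = \<bar>g x\<bar> * (d / ((s x)\<^sup>2 + d))"
        using d den[of x] by (simp add: abs_mult)
      also have "\<dots> \<le> \<bar>g x\<bar> * 1"
        using d den[of x] by (intro mult_left_mono) auto
      also have "\<dots> \<le> e / 2"
        using False x by (simp add: K_def)
      finally show ?thesis .
    qed
    ultimately show ?thesis by linarith
  qed
  ultimately show ?thesis by blast
qed

text \<open>Along each line in direction \<open>j\<close> the fundamental theorem of calculus leaves
  the difference of \<open>g\<close> on two opposite faces. The condition on the faces covers both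
  periodicity in directions 1 and 2 and vanishing on the walls in direction 3.\<close>

lemma Omega_integral_partial_zero:
  fixes g :: "real^3 \<Rightarrow> real"
  assumes der: "\<And>x. x \<in> slab k \<Longrightarrow> (g has_derivative (\<lambda>h. \<Sum>i\<in>UNIV. h$i * D i x)) (at x within slab k)"
    and cont: "continuous_on (slab k) (D j)"
    and faces: "\<And>x. x \<in> Omega k \<Longrightarrow> x$j = 0 \<Longrightarrow> g (x + axis j (corner $ j)) = g x"
  shows "Omega_integral k (D j) = 0"
proof -
  have contO: "continuous_on (cbox 0 corner) (D j)"
    using cont Omega_subset_slab continuous_on_subset unfolding Omega_def by blast
  have inner: "integral {0..corner $ j} (\<lambda>t. D j (fibre j (v, t))) = 0"
    if v: "v \<in> cbox (0, 0) (corner $ (j + 1), corner $ (j + 2))" for v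
  proof -
    have mem: "fibre j (v, t) \<in> Omega k" if "t \<in> {0..corner $ j}" for t
    proof -
      have "(v, t) \<in> cbox ((0, 0), 0) ((corner $ (j + 1), corner $ (j + 2)), corner $ j)"
        using v that by (simp add: cbox_Pair_eq)
      then have "fibre j (v, t) \<in> fibre j ` cbox ((0, 0), 0) ((corner $ (j + 1), corner $ (j + 2)), corner $ j)"
        by blast
      then show ?thesis
        unfolding fibre_image_cbox Omega_def using fibre_inverse[of j 0] by simp
    qed
    have shift: "fibre j (v, t) = fibre j (v, 0) + t *\<^sub>R axis j 1" for t
      by (auto simp: vec_eq_iff fibre_def axis_def)
    have "((\<lambda>t. g (fibre j (v, t))) has_vector_derivative D j (fibre j (v, t))) (at t within {0..corner $ j})"
      if t: "t \<in> {0..corner $ j}" for t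
    proof -
      have 1: "((\<lambda>t. fibre j (v, t)) has_derivative (\<lambda>h. h *\<^sub>R axis j 1)) (at t within {0..corner $ j})"
        by (subst shift[abs_def]) (auto intro!: derivative_eq_intros)
      \<comment> \<open>Differentiability is known only within the slab, so the chain rule is
        applied within the image of the segment.\<close>
      have 2: "(g has_derivative (\<lambda>h. \<Sum>i\<in>UNIV. h$i * D i (fibre j (v, t)))) (at (fibre j (v, t)) within
          (\<lambda>t. fibre j (v, t)) ` {0..corner $ j})"
        by (rule has_derivative_subset[OF der]) (use mem t Omega_subset_slab in blast)+
      have "(\<Sum>i\<in>UNIV. (h *\<^sub>R axis j 1) $ i * D i x) = h * D j x" for h x
        by (subst sum.remove[of _ j]) (auto simp: axis_def intro!: sum.neutral)
      then show ?thesis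
        using has_derivative_in_compose[OF 1 2] by (simp add: has_vector_derivative_def)
    qed
    then have "((\<lambda>t. D j (fibre j (v, t))) has_integral g (fibre j (v, corner $ j)) - g (fibre j (v, 0))) {0..corner $ j}"
      using corner_pos[of j] by (intro fundamental_theorem_of_calculus) auto
    moreover have "g (fibre j (v, corner $ j)) = g (fibre j (v, 0))"
    proof -
      have "fibre j (v, corner $ j) = fibre j (v, 0) + axis j (corner $ j)"
        by (auto simp: vec_eq_iff fibre_def axis_def)
      then show ?thesis
        using faces[of "fibre j (v, 0)"] mem[of 0] corner_pos[of j] by simp
    qed
    ultimately show ?thesis by (simp add: integral_unique)
  qed
  have "Omega_integral k (D j) = integral (cbox 0 corner) (D j)"
    using contO by (intro Omega_integral_eq) (simp add: Omega_def)
  also have "\<dots> = 0"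
    unfolding integral_fibre[OF contO, of j]
    by (subst Henstock_Kurzweil_Integration.integral_cong[where g = "\<lambda>_. 0"]) (use inner in auto)
  finally show ?thesis .
qed

end

section \<open>Scalar modes\<close>

text \<open>The phases of component \<open>i\<close> of a velocity mode. Differentiation in x_i
  undoes the shift in direction \<open>i\<close>, so all three terms of the divergence carry the
  phases \<open>phase p\<close>.\<close>

definition component_phase :: "3 \<Rightarrow> bit^2 \<Rightarrow> 3 \<Rightarrow> bit" where
  "component_phase i p j = phase p j + of_bool (i = j)"

text \<open>The scalar factor of a velocity component without amplitude, sign and
  \<open>Gnu_norm\<close>; for \<open>i = 3\<close> it is a temperature mode. It is defined for all
  wave vectors and phases, including those for which it vanishes identically.\<close>

definition component_mode :: "real^3 \<Rightarrow> 3 \<Rightarrow> (nat^3) \<times> (bit^2) \<Rightarrow> real^3 \<Rightarrow> real" where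
  "component_mode k i n x = eta (fst n) / Vconst * trig_prod k (fst n) (component_phase i (snd n)) x"

lemma component_phase_eq_iff [simp]: "component_phase i p = component_phase i p' \<longleftrightarrow> p = p'"
  by (auto simp: fun_eq_iff component_phase_def phase_def forall_3 vec_eq_iff forall_2)

lemma component_phase_3 [simp]: "component_phase i p 3 = of_bool (i = 3)"
  by (simp add: component_phase_def phase_def)

lemma Vconst_sq: "Vconst\<^sup>2 = 4 * pi ^ 3" and Vconst_pos: "Vconst > 0"
  by (auto simp: Vconst_def)

lemma eta_sq: "(eta m)\<^sup>2 = (\<Prod>j\<in>UNIV. 2 ^ iota (m$j))" and eta_pos: "eta m > 0"
proof -
  have "(sqrt 2 ^ iota l)\<^sup>2 = 2 ^ iota l" for l
    by (simp add: iota_def)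
  then show "(eta m)\<^sup>2 = (\<Prod>j\<in>UNIV. 2 ^ iota (m$j))"
    by (simp add: eta_def prod_power_distrib)
  show "eta m > 0"
    unfolding eta_def by (intro prod_pos) auto
qed

lemma temp_mode_eq: "temp_mode k (m, p, c) = component_mode k 3 (m, p)"
  by (auto simp: fun_eq_iff component_mode_def trig_prod_def prod_3 component_phase_def phase_def)

lemma continuous_on_component_mode [continuous_intros]: "continuous_on S (component_mode k i n)"
  unfolding component_mode_def by (intro continuous_intros)

lemma nu_nth: "nu (m, p, c) $ i = (\<Prod>j\<in>UNIV. real (iota (m$j)) ^ of_bit (component_phase i p j))"
  by (simp add: component_phase_def)

declare nu.simps [simp del]

lemma nu_cases: "nu (m, p, c) $ i = 0 \<or> nu (m, p, c) $ i = 1"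
proof -
  have "real (iota l) ^ of_bit b = 0 \<or> real (iota l) ^ of_bit b = 1" for l b
    by (auto simp: iota_def)
  then show ?thesis
    unfolding nu_nth prod_3 by (metis mult_eq_0_iff mult_1)
qed

text \<open>A zero of \<open>nu\<close> comes from a sine with wave number 0 among the three
  factors.\<close>

lemma component_mode_eq_0:
  assumes "nu (m, p, c) $ i = 0"
  shows "component_mode k i (m, p) x = 0"
proof -
  obtain j where j: "iota (m$j) = 0" "component_phase i p j = 1"
    using assms unfolding nu_nth by (auto split: if_splits)
  then have "trig (m$j) (component_phase i p j) (k$j * x$j) = 0"
    by (auto simp: iota_def split: if_splits)
  then show ?thesis
    by (auto simp: component_mode_def trig_prod_def)
qed

lemma trig_poly_component_mode_sum:
  assumes "trig_poly k r f" "r = of_bool (i = 3)"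
  shows "\<exists>F a. finite F \<and> (\<forall>x. f x = (\<Sum>n\<in>F. a n * component_mode k i n x))"
  using assms
proof (induction rule: trig_poly.induct)
  case (mode q r c m)
  \<comment> \<open>The solution of \<open>component_phase i p = q\<close>: adding the shift again
    removes it from the horizontal entries, and the third entry agrees by the hypothesis on
    \<open>r\<close>.\<close>
  define p :: "bit^2" where "p = (\<chi> l. if l = 1 then q 1 + of_bool (i = 1) else q 2 + of_bool (i = 2))"
  have "component_phase i p j = q j" for j
    using mode exhaust_3[of j] by (auto simp: component_phase_def phase_def p_def)
  then have "component_phase i p = q" by (simp add: fun_eq_iff)
  then have "c * trig_prod k m q x = c * Vconst / eta m * component_mode k i (m, p) x" for x
    using eta_pos[of m] Vconst_pos by (simp add: component_mode_def)
  then show ?case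
    by (intro exI[of _ "{(m, p)}"] exI[of _ "\<lambda>_. c * Vconst / eta m"]) auto
next
  case (add r f g)
  then obtain F a G b where F: "finite F" "\<And>x. f x = (\<Sum>n\<in>F. a n * component_mode k i n x)"
    and G: "finite G" "\<And>x. g x = (\<Sum>n\<in>G. b n * component_mode k i n x)"
    by auto
  have "f x + g x = (\<Sum>n\<in>F \<union> G. (of_bool (n \<in> F) * a n + of_bool (n \<in> G) * b n) * component_mode k i n x)" for x
  proof -
    have "(\<Sum>n\<in>F. a n * component_mode k i n x) = (\<Sum>n\<in>F \<union> G. of_bool (n \<in> F) * a n * component_mode k i n x)"
      using F G by (intro sum.mono_neutral_cong_left) auto
    moreover have "(\<Sum>n\<in>G. b n * component_mode k i n x) = (\<Sum>n\<in>F \<union> G. of_bool (n \<in> G) * b n * component_mode k i n x)"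
      using F G by (intro sum.mono_neutral_cong_left) auto
    ultimately show ?thesis
      by (simp add: F G distrib_right sum.distrib)
  qed
  then show ?case
    using F G by (intro exI[of _ "F \<union> G"] exI conjI) auto
qed

text \<open>Follows from |a + b|^2 being nonnegative. It replaces the triangle inequality in the L2
  estimates and supplies an integrable bound for squared differences.\<close>

lemma norm_diff_square_le: "(norm (a - b))\<^sup>2 \<le> 2 * (norm a)\<^sup>2 + 2 * (norm (b::'b::real_inner))\<^sup>2"
  using inner_ge_zero[of "a + b"]
  by (simp add: power2_norm_eq_inner inner_simps inner_commute del: inner_ge_zero)

context layer begin

text \<open>\<open>eta\<close> offsets the factor 1/2 of each nonconstant direction and
  \<open>Vconst\<close> the volume. What remains of the squared norm is 1, or 0 if some factor is
  identically zero.\<close>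

lemma mode_orthogonality:
  assumes "q 3 = q' 3"
  shows "Omega_integral k (\<lambda>x. (eta m / Vconst * trig_prod k m q x) * (eta n / Vconst * trig_prod k n q' x)) =
    of_bool (m = n \<and> q = q') * (\<Prod>j\<in>UNIV. real (iota (m$j)) ^ of_bit (q j))"
proof -
  have "Omega_integral k (\<lambda>x. (eta m / Vconst * trig_prod k m q x) * (eta n / Vconst * trig_prod k n q' x)) =
     Omega_integral k (\<lambda>x. (eta m * eta n / Vconst\<^sup>2) * (trig_prod k m q x * trig_prod k n q' x))"
    by (simp add: power2_eq_square mult_ac)
  also have "\<dots> = (eta m * eta n / Vconst\<^sup>2) * Omega_integral k (\<lambda>x. trig_prod k m q x * trig_prod k n q' x)"
    unfolding Omega_integral_def by (rule integral_mult_right_zero)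
  also have "\<dots> = of_bool (m = n \<and> q = q') * ((eta m)\<^sup>2 / (\<Prod>j\<in>UNIV. 2 ^ iota (m$j))) * (\<Prod>j\<in>UNIV. real (iota (m$j)) ^ of_bit (q j))"
    unfolding trig_prod_orthogonality[of q q', OF assms] Vconst_sq by (auto simp: power2_eq_square)
  finally show ?thesis
    using eta_pos[of m] by (simp add: eta_sq)
qed

text \<open>All modes of one component share their x_3 phase, so orthogonality holds over all wave
  vectors and phases. As \<open>nu\<close> is 0 or 1, the family is orthonormal up to identically
  zero members.\<close>

lemma component_mode_inner:
  "Omega_integral k (\<lambda>x. component_mode k i (m, p) x * component_mode k i (m', p') x) =
    of_bool (m = m' \<and> p = p') * nu (m, p, c) $ i"
  unfolding component_mode_def nu_nth by (subst mode_orthogonality) auto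

section \<open>Calculus of the integral over the domain and best approximation\<close>

lemma Omega_integral_add:
  "continuous_on (Omega k) f \<Longrightarrow> continuous_on (Omega k) g \<Longrightarrow>
    Omega_integral k (\<lambda>x. f x + g x) = Omega_integral k f + Omega_integral k g"
  unfolding Omega_integral_def by (intro Bochner_Integration.integral_add Omega_integral_eq(2))

lemma Omega_integral_diff:
  "continuous_on (Omega k) f \<Longrightarrow> continuous_on (Omega k) g \<Longrightarrow>
    Omega_integral k (\<lambda>x. f x - g x) = Omega_integral k f - Omega_integral k g"
  unfolding Omega_integral_def by (intro Bochner_Integration.integral_diff Omega_integral_eq(2))

lemma Omega_integral_sum:
  "(\<And>i. i \<in> I \<Longrightarrow> continuous_on (Omega k) (f i)) \<Longrightarrow>
    Omega_integral k (\<lambda>x. \<Sum>i\<in>I. f i x) = (\<Sum>i\<in>I. Omega_integral k (f i))"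
  unfolding Omega_integral_def by (intro Bochner_Integration.integral_sum Omega_integral_eq(2))

lemma Omega_integral_cmult: "Omega_integral k (\<lambda>x. c * f x) = c * Omega_integral k f"
  unfolding Omega_integral_def by (rule integral_mult_right_zero)

lemma Omega_integral_cong:
  "(\<And>x. x \<in> Omega k \<Longrightarrow> f x = g x) \<Longrightarrow> Omega_integral k f = Omega_integral k g"
  unfolding Omega_integral_def by (intro Bochner_Integration.integral_cong) auto

lemma Omega_integral_mono:
  "integrable (lebesgue_on (Omega k)) f \<Longrightarrow> integrable (lebesgue_on (Omega k)) g \<Longrightarrow>
    (\<And>x. x \<in> Omega k \<Longrightarrow> f x \<le> g x) \<Longrightarrow> Omega_integral k f \<le> Omega_integral k g"
  unfolding Omega_integral_def by (intro integral_mono) auto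

text \<open>The product with zero wave vector and zero phases is the constant 1, so the
  orthogonality relation already computes the volume.\<close>

lemma Omega_integral_const: "Omega_integral k (\<lambda>x. c) = c * Vconst\<^sup>2"
  using trig_prod_orthogonality[of "\<lambda>_. 0" "\<lambda>_. 0" 0 0, OF refl] Omega_integral_cmult[of c "\<lambda>_. 1"]
  by (simp add: trig_prod_def Vconst_sq iota_def)

text \<open>The volume is \<open>Vconst\<^sup>2\<close>, which explains the pointwise tolerance. The
  quarter leaves room for the sum over three components to stay below
  \<open>e\<^sup>2\<close>.\<close>

lemma Omega_integral_square_bound:
  assumes "continuous_on (Omega k) f" "\<And>x. x \<in> Omega k \<Longrightarrow> \<bar>f x\<bar> \<le> e / (2 * Vconst)" "0 < e"
  shows "Omega_integral k (\<lambda>x. (f x)\<^sup>2) \<le> e\<^sup>2 / 4"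
proof -
  have "Omega_integral k (\<lambda>x. (f x)\<^sup>2) \<le> Omega_integral k (\<lambda>x. (e / (2 * Vconst))\<^sup>2)"
  proof (rule Omega_integral_mono)
    show "(f x)\<^sup>2 \<le> (e / (2 * Vconst))\<^sup>2" if "x \<in> Omega k" for x
      using power_mono[OF assms(2)[OF that], of 2] by simp
  qed (intro Omega_integral_eq(2) continuous_intros assms)+
  also have "\<dots> = e\<^sup>2 / 4"
    unfolding Omega_integral_const using Vconst_pos by (simp add: power_divide power_mult_distrib)
  finally show ?thesis .
qed

text \<open>Component 3 consists of sines in x_3 and takes the approximation for functions vanishing
  on the walls; the other two consist of cosines and need no wall condition.\<close>

lemma component_mode_approx:
  assumes "continuous_on (slab k) g" "horizontally_periodic k g"
    and "i = 3 \<Longrightarrow> \<forall>x\<in>walls k. g x = 0" and "e > 0"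
  shows "\<exists>F a. finite F \<and> Omega_integral k (\<lambda>x. (g x - (\<Sum>n\<in>F. a n * component_mode k i n x))\<^sup>2) \<le> e\<^sup>2 / 4"
proof -
  have "e / (2 * Vconst) > 0" using assms(4) Vconst_pos by simp
  then obtain h where h: "trig_poly k (of_bool (i = 3)) h" "\<And>x. x \<in> Omega k \<Longrightarrow> \<bar>g x - h x\<bar> < e / (2 * Vconst)"
    using trig_poly_approx[OF assms(1,2)] trig_poly_approx_walls[OF assms(1,2)] assms(3)
    by (cases "i = 3") (simp, blast, simp, blast)
  obtain F a where F: "finite F" "\<And>x. h x = (\<Sum>n\<in>F. a n * component_mode k i n x)"
    using trig_poly_component_mode_sum[OF h(1)] by blast
  have "continuous_on (Omega k) g"
    using assms(1) Omega_subset_slab continuous_on_subset by blast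
  then have "Omega_integral k (\<lambda>x. (g x - h x)\<^sup>2) \<le> e\<^sup>2 / 4"
    using h assms(4) by (intro Omega_integral_square_bound continuous_on_diff continuous_on_trig_poly[OF h(1)]) (auto intro: less_imp_le)
  then show ?thesis
    using F by auto
qed

text \<open>Pythagoras: the residual \<open>r\<close> is orthogonal to every \<open>e n\<close> with
  \<open>n\<close> in \<open>F'\<close>. Allowing \<open>F \<subseteq> F'\<close> permits passing to
  a larger index set at no cost. The condition on \<open>c w n * N n\<close> says that
  \<open>N n = 1\<close> or the coefficient is zero, which admits identically zero members of the
  family.\<close>

lemma projection_minimal:
  fixes e :: "'i \<Rightarrow> real^3 \<Rightarrow> real"
  defines "c \<equiv> \<lambda>w n. Omega_integral k (\<lambda>x. w x * e n x)"
  assumes w: "continuous_on (Omega k) w" and e: "\<And>n. continuous_on (Omega k) (e n)"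
    and orth: "\<And>n n'. Omega_integral k (\<lambda>x. e n x * e n' x) = of_bool (n = n') * N n"
    and c: "\<And>n. c w n * N n = c w n"
    and F: "finite F'" "F \<subseteq> F'"
  shows "Omega_integral k (\<lambda>x. (w x - (\<Sum>n\<in>F'. c w n * e n x))\<^sup>2) \<le>
    Omega_integral k (\<lambda>x. (w x - (\<Sum>n\<in>F. a n * e n x))\<^sup>2)"
proof -
  define r where "r = (\<lambda>x. w x - (\<Sum>n\<in>F'. c w n * e n x))"
  \<comment> \<open>The coefficients \<open>a\<close> are extended by 0 to \<open>F'\<close>, so
    that both sums run over one index set.\<close>
  define d where "d = (\<lambda>n. c w n - (if n \<in> F then a n else 0))"
  define t where "t = (\<lambda>x. \<Sum>n\<in>F'. d n * e n x)"
  have cont: "continuous_on (Omega k) r" "continuous_on (Omega k) t"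
    unfolding r_def t_def by (intro continuous_intros w e)+
  have orth_r: "Omega_integral k (\<lambda>x. r x * e n x) = 0" if "n \<in> F'" for n
  proof -
    have "Omega_integral k (\<lambda>x. r x * e n x) =
        Omega_integral k (\<lambda>x. w x * e n x - (\<Sum>n'\<in>F'. c w n' * (e n' x * e n x)))"
      by (simp add: r_def left_diff_distrib sum_distrib_right mult.assoc)
    also have "\<dots> = c w n - (\<Sum>n'\<in>F'. c w n' * (of_bool (n' = n) * N n'))"
      unfolding c_def orth[symmetric] Omega_integral_cmult[symmetric]
      by (subst Omega_integral_diff)
         (auto intro!: continuous_intros w e Omega_integral_sum)
    also have "(\<Sum>n'\<in>F'. c w n' * (of_bool (n' = n) * N n')) = (\<Sum>n'\<in>F'. if n' = n then c w n' * N n' else 0)"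
      by (intro sum.cong) auto
    also have "\<dots> = c w n"
      using that F c by simp
    finally show ?thesis by simp
  qed
  have "Omega_integral k (\<lambda>x. r x * t x) = Omega_integral k (\<lambda>x. \<Sum>n\<in>F'. d n * (r x * e n x))"
    by (simp add: t_def sum_distrib_left mult_ac)
  also have "\<dots> = (\<Sum>n\<in>F'. d n * Omega_integral k (\<lambda>x. r x * e n x))"
    by (subst Omega_integral_sum) (auto intro!: continuous_intros cont e simp: Omega_integral_cmult)
  also have "\<dots> = 0" using orth_r by simp
  finally have rt: "Omega_integral k (\<lambda>x. r x * t x) = 0" .
  have "w x - (\<Sum>n\<in>F. a n * e n x) = r x + t x" for x
  proof -
    have "(\<Sum>n\<in>F. a n * e n x) = (\<Sum>n\<in>F'. (if n \<in> F then a n else 0) * e n x)"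
      using F by (intro sum.mono_neutral_cong_left) auto
    then show ?thesis
      by (simp add: r_def t_def d_def left_diff_distrib sum_subtractf)
  qed
  then have "Omega_integral k (\<lambda>x. (w x - (\<Sum>n\<in>F. a n * e n x))\<^sup>2) =
      Omega_integral k (\<lambda>x. (r x)\<^sup>2 + (2 * (r x * t x) + (t x)\<^sup>2))"
    by (simp add: power2_sum algebra_simps)
  also have "\<dots> = Omega_integral k (\<lambda>x. (r x)\<^sup>2) + (2 * Omega_integral k (\<lambda>x. r x * t x) + Omega_integral k (\<lambda>x. (t x)\<^sup>2))"
    by (simp add: Omega_integral_add Omega_integral_cmult[symmetric] cont continuous_intros)
  also have "\<dots> \<ge> Omega_integral k (\<lambda>x. (r x)\<^sup>2)"
    using rt by (simp add: Omega_integral_def)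
  finally show ?thesis
    by (simp add: r_def)
qed

section \<open>Square-integrable functions and closures\<close>

lemma L2_continuous:
  fixes u :: "real^3 \<Rightarrow> 'b::euclidean_space"
  assumes "continuous_on (Omega k) u"
  shows "u \<in> L2 k"
proof -
  have "integrable (lebesgue_on (Omega k)) u"
    using assms continuous_imp_integrable unfolding Omega_def by blast
  moreover have "integrable (lebesgue_on (Omega k)) (\<lambda>x. (norm (u x))\<^sup>2)"
    by (intro Omega_integral_eq(2) continuous_intros assms)
  ultimately show ?thesis
    by (auto simp: L2_def)
qed

lemma L2_diff:
  fixes u w :: "real^3 \<Rightarrow> 'b::euclidean_space"
  assumes "u \<in> L2 k" "w \<in> L2 k"
  shows "(\<lambda>x. u x - w x) \<in> L2 k"
proof -
  have [measurable]: "u \<in> borel_measurable (lebesgue_on (Omega k))" "w \<in> borel_measurable (lebesgue_on (Omega k))"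
    using assms by (auto simp: L2_def)
  have "integrable (lebesgue_on (Omega k)) (\<lambda>x. 2 * (norm (u x))\<^sup>2 + 2 * (norm (w x))\<^sup>2)"
    using assms by (auto simp: L2_def)
  then have "integrable (lebesgue_on (Omega k)) (\<lambda>x. (norm (u x - w x))\<^sup>2)"
    by (rule Bochner_Integration.integrable_bound) (auto intro!: norm_diff_square_le AE_I2)
  then show ?thesis by (auto simp: L2_def)
qed

lemma L2_norm_less_iff:
  assumes "0 < \<epsilon>"
  shows "L2_norm k u < \<epsilon> \<longleftrightarrow> Omega_integral k (\<lambda>x. (norm (u x))\<^sup>2) < \<epsilon>\<^sup>2"
  using assms unfolding L2_norm_def L2_inner_def power2_norm_eq_inner
  by (metis abs_of_pos real_sqrt_abs real_sqrt_less_iff)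

text \<open>Reduces density in a closure to density in the generating set \<open>S\<close>, that is,
  to smooth functions. With squared norms the two errors combine to
  \<open>2 * (\<epsilon> / 2)\<^sup>2 + 2 * (\<epsilon> / 2)\<^sup>2\<close>, exactly
  \<open>\<epsilon>\<^sup>2\<close>.\<close>

lemma L2_closure_dense:
  fixes e :: "'i \<Rightarrow> real^3 \<Rightarrow> 'b::euclidean_space"
  assumes cont: "\<And>n. n \<in> N \<Longrightarrow> continuous_on (Omega k) (e n)"
    and dense: "\<And>w \<epsilon>. w \<in> S \<Longrightarrow> \<epsilon> > 0 \<Longrightarrow> \<exists>F a. finite F \<and> F \<subseteq> N \<and>
      L2_norm k (\<lambda>x. w x - (\<Sum>n\<in>F. a n *\<^sub>R e n x)) < \<epsilon>"
    and u: "u \<in> L2_closure k S" and \<epsilon>: "\<epsilon> > 0"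
  shows "\<exists>F a. finite F \<and> F \<subseteq> N \<and> L2_norm k (\<lambda>x. u x - (\<Sum>n\<in>F. a n *\<^sub>R e n x)) < \<epsilon>"
proof -
  have "\<epsilon> / 2 > 0" using \<epsilon> by simp
  then obtain w where w: "w \<in> S" "w \<in> L2 k" "L2_norm k (\<lambda>x. u x - w x) < \<epsilon> / 2"
    using u unfolding L2_closure_def by blast
  obtain F a where F: "finite F" "F \<subseteq> N" "L2_norm k (\<lambda>x. w x - (\<Sum>n\<in>F. a n *\<^sub>R e n x)) < \<epsilon> / 2"
    using dense[OF w(1), of "\<epsilon> / 2"] \<epsilon> by auto
  define s where "s = (\<lambda>x. \<Sum>n\<in>F. a n *\<^sub>R e n x)"
  have "s \<in> L2 k"
    unfolding s_def using cont F(2) by (intro L2_continuous continuous_intros) blast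
  moreover have "u \<in> L2 k" using u by (simp add: L2_closure_def)
  ultimately have "(\<lambda>x. u x - w x) \<in> L2 k" "(\<lambda>x. w x - s x) \<in> L2 k" "(\<lambda>x. u x - s x) \<in> L2 k"
    using w(2) by (simp_all add: L2_diff)
  then have int: "integrable (lebesgue_on (Omega k)) (\<lambda>x. (norm (u x - w x))\<^sup>2)"
      "integrable (lebesgue_on (Omega k)) (\<lambda>x. (norm (w x - s x))\<^sup>2)"
      "integrable (lebesgue_on (Omega k)) (\<lambda>x. (norm (u x - s x))\<^sup>2)"
    unfolding L2_def by blast+
  have "Omega_integral k (\<lambda>x. (norm (u x - s x))\<^sup>2) \<le>
      Omega_integral k (\<lambda>x. 2 * (norm (u x - w x))\<^sup>2 + 2 * (norm (w x - s x))\<^sup>2)"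
  proof (rule Omega_integral_mono)
    show "(norm (u x - s x))\<^sup>2 \<le> 2 * (norm (u x - w x))\<^sup>2 + 2 * (norm (w x - s x))\<^sup>2" for x
      using norm_diff_square_le[of "u x - w x" "s x - w x"] by (simp add: norm_minus_commute)
  qed (use int in auto)
  also have "\<dots> = 2 * Omega_integral k (\<lambda>x. (norm (u x - w x))\<^sup>2) + 2 * Omega_integral k (\<lambda>x. (norm (w x - s x))\<^sup>2)"
    unfolding Omega_integral_def using int by simp
  also have "\<dots> < 2 * (\<epsilon> / 2)\<^sup>2 + 2 * (\<epsilon> / 2)\<^sup>2"
    using w(3) F(3) unfolding L2_norm_less_iff[OF \<open>\<epsilon> / 2 > 0\<close>] s_def by linarith
  also have "\<dots> = \<epsilon>\<^sup>2" by (simp add: power2_eq_square)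
  finally have "L2_norm k (\<lambda>x. u x - s x) < \<epsilon>"
    using \<epsilon> by (simp add: L2_norm_less_iff)
  then show ?thesis
    using F unfolding s_def by blast
qed

lemma L2_closure_superset:
  assumes "u \<in> S" "u \<in> L2 k"
  shows "u \<in> L2_closure k S"
proof -
  have "L2_norm k (\<lambda>x. u x - u x) = 0"
    by (simp add: L2_norm_def L2_inner_def Omega_integral_def)
  then show ?thesis
    using assms unfolding L2_closure_def by force
qed

section \<open>The temperature basis\<close>

lemma trig_prod_shift:
  assumes "j = 1 \<or> j = 2"
  shows "trig_prod k m q (x + axis j (2 * pi / k$j)) = trig_prod k m q x"
  using assms trig_shift_period[OF k_pos] by (auto simp: trig_prod_def prod_3 axis_def)

lemma component_mode_shift:
  assumes "j = 1 \<or> j = 2"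
  shows "component_mode k i n (x + axis j (2 * pi / k$j)) = component_mode k i n x"
  using trig_prod_shift[OF assms] by (simp add: component_mode_def)

lemma component_mode_walls:
  assumes "x \<in> walls k"
  shows "component_mode k 3 n x = 0"
proof -
  have "trig (fst n $ 3) 1 (k$3 * x$3) = 0"
    using assms k_pos[of 3] by (auto simp: walls_def trig_def)
  then show ?thesis by (simp add: component_mode_def trig_prod_def prod_3)
qed

text \<open>The admissible temperature indices are those whose mode is not identically zero: a
  positive third wave number rules out the zero sine in x_3, and \<open>temp_phases\<close> the
  horizontal ones.\<close>

lemma N_theta_nu: "(m, p, 1) \<in> N_theta \<longleftrightarrow> nu (m, p, 1) $ 3 = 1"
  by (cases "p$1"; cases "p$2")
     (auto simp: N_theta_def temp_phases_def nu_nth prod_3 component_phase_def phase_def iota_def)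

lemma temp_mode_inner:
  assumes "n \<in> N_theta" "n' \<in> N_theta"
  shows "Omega_integral k (\<lambda>x. temp_mode k n x * temp_mode k n' x) = of_bool (n = n')"
proof -
  obtain m p m' p' where n: "n = (m, p, 1)" "n' = (m', p', 1)"
    using assms by (auto simp: N_theta_def)
  then have "nu (m, p, 1) $ 3 = 1" using assms N_theta_nu by blast
  then show ?thesis
    unfolding n temp_mode_eq by (subst component_mode_inner[where c = 1]) auto
qed

lemma temp_mode_in_L2_0: "temp_mode k n \<in> L2_0 k"
proof -
  obtain m p c where n: "n = (m, p, c)" by (cases n)
  \<comment> \<open>The scalar mode in the shape required by \<open>smooth_on_sum_trig_prod\<close>:
    only the summand \<open>i = 1\<close> has a nonzero coefficient.\<close>
  have "smooth_on (slab k) (\<lambda>x. \<Sum>i\<in>UNIV. trig_prod k m (component_phase 3 p) x *\<^sub>R (if i = (1::3) then eta m / Vconst else 0))"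
    by (rule smooth_on_sum_trig_prod)
  also have "(\<lambda>x. \<Sum>i\<in>UNIV. trig_prod k m (component_phase 3 p) x *\<^sub>R (if i = (1::3) then eta m / Vconst else 0)) = temp_mode k n"
    unfolding n temp_mode_eq by (simp add: fun_eq_iff component_mode_def sum_3)
  finally have "temp_mode k n \<in> {\<phi>. smooth_on (slab k) \<phi> \<and> horizontally_periodic k \<phi> \<and> (\<forall>x\<in>walls k. \<phi> x = 0)}"
    using component_mode_shift component_mode_walls unfolding n temp_mode_eq horizontally_periodic_def by auto
  then show ?thesis
    unfolding L2_0_def by (rule L2_closure_superset) (unfold n temp_mode_eq, intro L2_continuous continuous_intros)
qed

lemma temp_mode_dense:
  assumes "smooth_on (slab k) w" "horizontally_periodic k w" "\<forall>x\<in>walls k. w x = 0" "\<epsilon> > 0"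
  shows "\<exists>F a. finite F \<and> F \<subseteq> N_theta \<and> L2_norm k (\<lambda>x. w x - (\<Sum>n\<in>F. a n *\<^sub>R temp_mode k n x)) < \<epsilon>"
proof -
  obtain F a where F: "finite F"
      "Omega_integral k (\<lambda>x. (w x - (\<Sum>n\<in>F. a n * component_mode k 3 n x))\<^sup>2) \<le> \<epsilon>\<^sup>2 / 4"
    using component_mode_approx[OF smooth_on_imp_continuous_on[OF assms(1)] assms(2), of 3 \<epsilon>] assms(3,4) by auto
  \<comment> \<open>Inadmissible indices of \<open>F\<close> are dropped without changing the sum,
    as their modes are zero; the others receive the component label 1.\<close>
  define G where "G = {n \<in> N_theta. (fst n, fst (snd n)) \<in> F}"
  define h where "h = (\<lambda>(m :: nat^3, p :: bit^2). (m, p, 1 :: nat))"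
  have hG: "G = h ` {n \<in> F. h n \<in> N_theta}"
    by (force simp: G_def h_def N_theta_def)
  have inj: "inj_on h A" for A by (auto simp: inj_on_def h_def)
  have "(\<Sum>n\<in>G. a (fst n, fst (snd n)) *\<^sub>R temp_mode k n x) = (\<Sum>n\<in>F. a n * component_mode k 3 n x)" for x
  proof -
    have "(\<Sum>n\<in>G. a (fst n, fst (snd n)) *\<^sub>R temp_mode k n x) =
        (\<Sum>n\<in>{n \<in> F. h n \<in> N_theta}. a n * component_mode k 3 n x)"
      unfolding hG by (subst sum.reindex[OF inj]) (auto simp: h_def temp_mode_eq simp del: temp_mode.simps intro!: sum.cong)
    also have "\<dots> = (\<Sum>n\<in>F. a n * component_mode k 3 n x)"
    proof (rule sum.mono_neutral_left)
      show "\<forall>n\<in>F - {n \<in> F. h n \<in> N_theta}. a n * component_mode k 3 n x = 0"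
      proof
        fix n assume "n \<in> F - {n \<in> F. h n \<in> N_theta}"
        then obtain m p where n: "n = (m, p)" "(m, p, 1) \<notin> N_theta"
          by (cases n) (auto simp: h_def)
        then have "nu (m, p, 1) $ 3 = 0"
          using N_theta_nu nu_cases by blast
        then show "a n * component_mode k 3 n x = 0"
          unfolding n by (simp add: component_mode_eq_0)
      qed
    qed (use F in auto)
    finally show ?thesis .
  qed
  moreover have "Omega_integral k (\<lambda>x. (w x - (\<Sum>n\<in>F. a n * component_mode k 3 n x))\<^sup>2) < \<epsilon>\<^sup>2"
    using F(2) assms(4) zero_less_power[of \<epsilon> 2] by linarith
  ultimately have "L2_norm k (\<lambda>x. w x - (\<Sum>n\<in>G. a (fst n, fst (snd n)) *\<^sub>R temp_mode k n x)) < \<epsilon>"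
    using assms(4) by (simp add: L2_norm_less_iff)
  moreover have "finite G" "G \<subseteq> N_theta"
    unfolding hG using F by auto
  ultimately show ?thesis by (intro exI[of _ G] exI conjI) auto
qed

lemma temp_mode_orthonormal_basis: "orthonormal_basis k (L2_0 k) N_theta (temp_mode k)"
  unfolding orthonormal_basis_def
proof (intro conjI ballI allI impI)
  show "temp_mode k n \<in> L2_0 k" for n by (rule temp_mode_in_L2_0)
  show "L2_inner k (temp_mode k n) (temp_mode k n') = of_bool (n = n')" if "n \<in> N_theta" "n' \<in> N_theta" for n n'
    using temp_mode_inner[OF that] by (simp add: L2_inner_def)
  show "\<exists>F a. finite F \<and> F \<subseteq> N_theta \<and> L2_norm k (\<lambda>x. u x - (\<Sum>n\<in>F. a n *\<^sub>R temp_mode k n x)) < \<epsilon>"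
    if "u \<in> L2_0 k" "\<epsilon> > 0" for u \<epsilon>
    using that(1) unfolding L2_0_def
  proof (rule L2_closure_dense[rotated 2])
    show "continuous_on (Omega k) (temp_mode k n)" for n
      by (cases n) (simp only: temp_mode_eq continuous_on_component_mode)
  qed (use temp_mode_dense that(2) in auto)
qed

end

section \<open>Velocity modes\<close>

lemma wave_nth [simp]: "wave k m $ j = k$j * real (m$j)"
proof -
  have "(\<Sum>i\<in>UNIV. (if j = i then k$j else 0) * real (m$i)) = (\<Sum>i\<in>UNIV. if i = j then k$j * real (m$j) else 0)"
    by (intro sum.cong) auto
  then show ?thesis
    by (simp add: wave_def diag_def matrix_vector_mult_def)
qed

text \<open>The diagonals of \<open>Gmat\<close> as amplitude vectors, orthogonal to the wave vector
  and to each other. For positive \<open>k\<close> a nonzero wave vector has nonnegative entries and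
  is never parallel to (1, 1, -1), so neither vector vanishes.\<close>

definition gvec :: "real^3 \<Rightarrow> nat^3 \<Rightarrow> nat \<Rightarrow> real^3" where
  "gvec k m c = (if c = 1 then cross3 gamma_vec (wave k m)
     else cross3 (wave k m) (cross3 gamma_vec (wave k m)))"

lemma Gmat_eq: "Gmat k (m, p, c) = diag (gvec k m c)"
  by (simp add: gvec_def)

lemma diag_nth [simp]: "diag d $ i $ i = d $ i"
  by (simp add: diag_def)

lemma diag_mult_vec [simp]: "(diag d *v x) $ i = d $ i * x $ i"
proof -
  have "(\<Sum>j\<in>UNIV. (if i = j then d$i else 0) * x$j) = (\<Sum>j\<in>UNIV. if j = i then d$i * x$i else 0)"
    by (intro sum.cong) auto
  then show ?thesis by (simp add: diag_def matrix_vector_mult_def)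
qed

lemma gvec_1:
  "gvec k m 1 $ 1 = wave k m $ 3 + wave k m $ 2"
  "gvec k m 1 $ 2 = - wave k m $ 1 - wave k m $ 3"
  "gvec k m 1 $ 3 = wave k m $ 2 - wave k m $ 1"
  by (simp_all add: gvec_def cross3_def gamma_vec_def)

lemma gvec_2:
  "gvec k m 2 $ 1 = wave k m $ 2 * gvec k m 1 $ 3 - wave k m $ 3 * gvec k m 1 $ 2"
  "gvec k m 2 $ 2 = wave k m $ 3 * gvec k m 1 $ 1 - wave k m $ 1 * gvec k m 1 $ 3"
  "gvec k m 2 $ 3 = wave k m $ 1 * gvec k m 1 $ 2 - wave k m $ 2 * gvec k m 1 $ 1"
  by (simp_all add: gvec_def cross3_def)

lemma gvec_orthogonal_wave: "(\<Sum>j\<in>UNIV. gvec k m c $ j * wave k m $ j) = 0"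
proof -
  have "gvec k m c \<bullet> wave k m = 0"
    by (simp add: gvec_def dot_cross_self)
  then show ?thesis by (simp add: inner_vec_def)
qed

lemma gvec_orthogonal: "(\<Sum>j\<in>UNIV. gvec k m 1 $ j * gvec k m 2 $ j) = 0"
  unfolding sum_3 gvec_2 by (simp add: algebra_simps)

text \<open>The sign that appears when component \<open>i\<close> of a mode is differentiated in
  x_i. The equal sign built into the velocity mode cancels it, and the divergence reduces to the
  inner product of \<open>gvec\<close> and \<open>wave\<close>.\<close>

definition phase_sign :: "bit^2 \<Rightarrow> 3 \<Rightarrow> real" where
  "phase_sign p i = (-1) ^ of_bit (phase p i)"

lemma phase_sign_sq [simp]: "phase_sign p i * phase_sign p i = 1"
  by (simp add: phase_sign_def)

lemma varsigma_nth: "varsigma p $ i $ i = phase_sign p i"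
  using exhaust_3[of i] by (auto simp: varsigma_def phase_sign_def phase_def)

lemma vel_mode_nth:
  "vel_mode k (m, p, c) x $ i =
     gvec k m c $ i * phase_sign p i / Gnu_norm k (m, p, c) * component_mode k i (m, p) x"
  unfolding component_mode_def
  by (simp add: varsigma_nth trig_prod_def component_phase_def gvec_def)

declare vel_mode.simps [simp del] Gmat.simps [simp del]

lemma Gnu_norm_sq: "(Gnu_norm k (m, p, c))\<^sup>2 = (\<Sum>i\<in>UNIV. (gvec k m c $ i)\<^sup>2 * nu (m, p, c) $ i)"
proof -
  have "gvec k m c $ i * nu (m, p, c) $ i * (gvec k m c $ i * nu (m, p, c) $ i) =
      (gvec k m c $ i)\<^sup>2 * nu (m, p, c) $ i" for i
    using nu_cases[of m p c i] by (auto simp: power2_eq_square)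
  then show ?thesis
    unfolding Gnu_norm_def Gmat_eq power2_norm_eq_inner inner_vec_def
    by (simp only: diag_mult_vec inner_real_def)
qed

lemma nu_eq:
  "nu (m, p, c) $ 1 = of_bool ((p$1 = 1 \<or> m$1 > 0) \<and> (p$2 = 0 \<or> m$2 > 0))"
  "nu (m, p, c) $ 2 = of_bool ((p$1 = 0 \<or> m$1 > 0) \<and> (p$2 = 1 \<or> m$2 > 0))"
  "nu (m, p, c) $ 3 = of_bool ((p$1 = 0 \<or> m$1 > 0) \<and> (p$2 = 0 \<or> m$2 > 0) \<and> m$3 > 0)"
  by (cases "p$1"; cases "p$2"; simp add: nu_nth prod_3 component_phase_def phase_def iota_def)+

text \<open>Each clause concerns a wave vector along one axis and excludes the phases for which no
  component off that axis survives. As implications they are ready for case analysis together with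
  \<open>nu_eq\<close>.\<close>

lemma vel_phases_eq:
  "vel_phases m =
    {p. (m$2 = 0 \<and> m$3 = 0 \<and> m$1 > 0 \<longrightarrow> p$2 = 1) \<and> (m$1 = 0 \<and> m$3 = 0 \<and> m$2 > 0 \<longrightarrow> p$1 = 1) \<and>
        (m$1 = 0 \<and> m$2 = 0 \<and> m$3 > 0 \<longrightarrow> p$1 \<noteq> p$2)}"
proof -
  have "p = vector [0, 1] \<or> p = vector [1, 0] \<longleftrightarrow> p$1 \<noteq> p$2" for p :: "bit^2"
    by (cases "p$1"; cases "p$2"; simp add: vec_eq_iff forall_2)
  moreover have "b = 0 \<or> b = 1" for b :: bit by (cases b) auto
  ultimately show ?thesis
    unfolding vel_phases_def by auto
qed

lemma vec3_nonzero_iff: "(m::nat^3) \<noteq> 0 \<longleftrightarrow> m$1 > 0 \<or> m$2 > 0 \<or> m$3 > 0"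
  by (auto simp: vec_eq_iff forall_3)

lemma N_u_iff:
  "(m, p, c) \<in> N_u \<longleftrightarrow> m \<noteq> 0 \<and> p \<in> vel_phases m \<and> (c = 1 \<or> c = 2 \<and> m$1 > 0 \<and> m$2 > 0 \<and> m$3 > 0)"
  by (auto simp: N_u_def vel_components_def)

section \<open>Nondegeneracy and span of the amplitudes, inner products\<close>

context layer begin

lemma wave_pos_iff: "wave k m $ j > 0 \<longleftrightarrow> m$j > 0" and wave_nonneg: "wave k m $ j \<ge> 0"
  using k_pos[of j] by (auto simp: zero_less_mult_iff)

lemma wave_zero_iff: "wave k m $ j = 0 \<longleftrightarrow> m$j = 0"
  using k_pos[of j] by auto

text \<open>Some component has a nonzero amplitude and a surviving mode. For \<open>c = 1\<close>
  the first two amplitudes are, up to sign, sums of nonnegative wave numbers, and admissible phases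
  keep a nonzero one alive; for \<open>c = 2\<close> every component mode survives.\<close>

lemma Gnu_norm_pos:
  assumes "(m, p, c) \<in> N_u"
  shows "Gnu_norm k (m, p, c) > 0"
proof -
  define K where "K = wave k m"
  have K: "K$j \<ge> 0" "K$j > 0 \<longleftrightarrow> m$j > 0" for j
    using wave_pos_iff wave_nonneg by (auto simp: K_def simp del: wave_nth)
  have "\<exists>i. gvec k m c $ i \<noteq> 0 \<and> nu (m, p, c) $ i = 1"
  proof (cases "c = 1")
    case True
    have "(nu (m, p, c) $ 1 = 1 \<and> K$3 + K$2 > 0) \<or> (nu (m, p, c) $ 2 = 1 \<and> - K$1 - K$3 < 0)"
    proof -
      have "K$3 + K$2 > 0 \<longleftrightarrow> m$3 > 0 \<or> m$2 > 0" "- K$1 - K$3 < 0 \<longleftrightarrow> m$1 > 0 \<or> m$3 > 0"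
        using K(1)[of 1] K(1)[of 2] K(1)[of 3] K(2)[of 1] K(2)[of 2] K(2)[of 3] by linarith+
      then show ?thesis
        using assms unfolding N_u_iff vel_phases_eq vec3_nonzero_iff nu_eq
        by (cases "p$1"; cases "p$2"; cases "m$1 > 0"; cases "m$2 > 0"; cases "m$3 > 0") auto
    qed
    then show ?thesis
      using True gvec_1[of k m] unfolding K_def by (metis less_irrefl)
  next
    case False
    then have m: "m$1 > 0" "m$2 > 0" "m$3 > 0" "c = 2"
      using assms by (auto simp: N_u_iff)
    have "gvec k m 2 $ 1 = K$2 * K$2 - K$1 * K$2 + K$3 * K$1 + K$3 * K$3"
      "gvec k m 2 $ 2 = K$3 * K$3 + K$2 * K$3 + K$1 * K$1 - K$1 * K$2"
      unfolding gvec_2 gvec_1 K_def[symmetric] by (simp_all add: algebra_simps)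
    \<comment> \<open>Individually the two entries can have either sign; their sum is a square plus
      positive terms.\<close>
    then have "gvec k m 2 $ 1 + gvec k m 2 $ 2 = (K$1 - K$2)\<^sup>2 + 2 * (K$3 * K$3) + K$1 * K$3 + K$2 * K$3"
      by (simp add: power2_eq_square algebra_simps)
    moreover have "K$3 * K$3 > 0" "K$1 * K$3 > 0" "K$2 * K$3 > 0"
      using m K by auto
    ultimately have "gvec k m 2 $ 1 + gvec k m 2 $ 2 > 0"
      using zero_le_power2[of "K$1 - K$2"] by linarith
    then have "gvec k m 2 $ 1 \<noteq> 0 \<or> gvec k m 2 $ 2 \<noteq> 0" by linarith
    moreover have "nu (m, p, c) $ 1 = 1" "nu (m, p, c) $ 2 = 1"
      using m by (auto simp: nu_eq)
    ultimately show ?thesis using m by blast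
  qed
  then obtain i where i: "gvec k m c $ i \<noteq> 0" "nu (m, p, c) $ i = 1" by blast
  have "0 < (gvec k m c $ i)\<^sup>2 * nu (m, p, c) $ i"
    using i by simp
  also have "\<dots> \<le> (\<Sum>i\<in>UNIV. (gvec k m c $ i)\<^sup>2 * nu (m, p, c) $ i)"
  proof (rule member_le_sum)
    show "0 \<le> (gvec k m c $ j)\<^sup>2 * nu (m, p, c) $ j" for j
      using nu_cases[of m p c j] by auto
  qed auto
  finally have "(Gnu_norm k (m, p, c))\<^sup>2 > 0"
    unfolding Gnu_norm_sq .
  moreover have "Gnu_norm k (m, p, c) \<ge> 0" by (simp add: Gnu_norm_def)
  ultimately show ?thesis by (metis less_eq_real_def power_zero_numeral less_irrefl)
qed

text \<open>The linear algebra behind completeness. With all wave numbers positive, the two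
  amplitude vectors span the plane orthogonal to the wave vector. If some wave number of a nonzero
  wave vector is 0, support and orthogonality leave one dimension, generated by
  \<open>gvec k m 1\<close> cut down by \<open>nu\<close>, or nothing if the phase is
  inadmissible.\<close>

lemma amplitude_span:
  fixes \<alpha> :: "3 \<Rightarrow> real"
  assumes sup: "\<And>i. nu (m, p, c0) $ i = 0 \<Longrightarrow> \<alpha> i = 0"
    and div: "(\<Sum>i\<in>UNIV. \<alpha> i * wave k m $ i) = 0"
    and zero: "\<And>i. m = 0 \<Longrightarrow> \<alpha> i = 0"
  shows "\<exists>b. \<forall>i. \<alpha> i = (\<Sum>c | (m, p, c) \<in> N_u. b c * gvec k m c $ i) * nu (m, p, c0) $ i"
proof -
  define K where "K = wave k m"
  have K: "K$j \<ge> 0" "K$j > 0 \<longleftrightarrow> m$j > 0" "K$j = 0 \<longleftrightarrow> m$j = 0" for j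
    using wave_pos_iff wave_nonneg wave_zero_iff by (auto simp: K_def simp del: wave_nth)
  have div': "\<alpha> 1 * K$1 + \<alpha> 2 * K$2 + \<alpha> 3 * K$3 = 0"
    using div by (simp add: sum_3 K_def del: wave_nth)
  show ?thesis
  proof (cases "m$1 > 0 \<and> m$2 > 0 \<and> m$3 > 0")
    case True
    define g where "g = gvec k m 1"
    define h where "h = gvec k m 2"
    have "m \<noteq> 0" "p \<in> vel_phases m"
      using True by (auto simp: vec3_nonzero_iff vel_phases_eq)
    then have "{c. (m, p, c) \<in> N_u} = {1, 2}"
      using True by (auto simp: N_u_iff)
    then have C: "(\<Sum>c | (m, p, c) \<in> N_u. b c * gvec k m c $ i) = b 1 * g$i + b 2 * h$i" for b :: "nat \<Rightarrow> real" and i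
      by (simp add: g_def h_def)
    have nu1: "nu (m, p, c0) $ i = 1" for i
      using True exhaust_3[of i] by (auto simp: nu_eq)
    have gK: "g$1 * K$1 + g$2 * K$2 + g$3 * K$3 = 0"  "h$1 * K$1 + h$2 * K$2 + h$3 * K$3 = 0"
      using gvec_orthogonal_wave[of k m] by (auto simp: sum_3 K_def g_def h_def simp del: wave_nth)
    \<comment> \<open>The third entry of the cross product of \<open>g\<close> and \<open>h\<close>.
      As \<open>h\<close> is the cross product of \<open>K\<close> and \<open>g\<close>, and
      \<open>g\<close> is orthogonal to \<open>K\<close>, that vector is |g|^2 times
      \<open>K\<close>.\<close>
    define D where "D = g$1 * h$2 - g$2 * h$1"
    have "D = K$3 * ((g$1)\<^sup>2 + (g$2)\<^sup>2 + (g$3)\<^sup>2) - g$3 * (g$1 * K$1 + g$2 * K$2 + g$3 * K$3)"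
      unfolding D_def h_def gvec_2 g_def[symmetric] K_def[symmetric]
      by (simp add: algebra_simps power2_eq_square)
    moreover have "g$1 > 0"
      using K True unfolding g_def gvec_1 K_def[symmetric] by (simp add: add_pos_pos)
    ultimately have "D > 0"
      using gK K(2)[of 3] True by (simp add: add_pos_nonneg)
    \<comment> \<open>Cramer's rule for the first two entries; the third then follows from
      orthogonality to the wave vector and \<open>K$3 > 0\<close>.\<close>
    define b where "b = (\<lambda>c::nat. if c = 1 then (\<alpha> 1 * h$2 - \<alpha> 2 * h$1) / D else (g$1 * \<alpha> 2 - g$2 * \<alpha> 1) / D)"
    have D: "b 1 * D = \<alpha> 1 * h$2 - \<alpha> 2 * h$1" "b 2 * D = g$1 * \<alpha> 2 - g$2 * \<alpha> 1"
      using \<open>D > 0\<close> by (auto simp: b_def)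
    have "D * (b 1 * g$1 + b 2 * h$1) = D * \<alpha> 1"
    proof -
      have "D * (b 1 * g$1 + b 2 * h$1) = (b 1 * D) * g$1 + (b 2 * D) * h$1" by (simp add: algebra_simps)
      then show ?thesis unfolding D by (simp add: D_def algebra_simps)
    qed
    then have 1: "b 1 * g$1 + b 2 * h$1 = \<alpha> 1" using \<open>D > 0\<close> by simp
    have "D * (b 1 * g$2 + b 2 * h$2) = D * \<alpha> 2"
    proof -
      have "D * (b 1 * g$2 + b 2 * h$2) = (b 1 * D) * g$2 + (b 2 * D) * h$2" by (simp add: algebra_simps)
      then show ?thesis unfolding D by (simp add: D_def algebra_simps)
    qed
    then have 2: "b 1 * g$2 + b 2 * h$2 = \<alpha> 2" using \<open>D > 0\<close> by simp
    have "(b 1 * g$3 + b 2 * h$3) * K$3 = b 1 * (g$1 * K$1 + g$2 * K$2 + g$3 * K$3)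
        + b 2 * (h$1 * K$1 + h$2 * K$2 + h$3 * K$3) - (b 1 * g$1 + b 2 * h$1) * K$1 - (b 1 * g$2 + b 2 * h$2) * K$2"
      by (simp add: algebra_simps)
    also have "\<dots> = \<alpha> 3 * K$3"
      unfolding gK 1 2 using div' by simp
    finally have 3: "b 1 * g$3 + b 2 * h$3 = \<alpha> 3"
      using K(3)[of 3] True by simp
    have "\<alpha> i = b 1 * g$i + b 2 * h$i" for i
      using exhaust_3[of i] 1 2 3 by auto
    then show ?thesis
      unfolding C nu1 by auto
  next
    case False
    show ?thesis
    proof (cases "m \<noteq> 0 \<and> p \<in> vel_phases m")
      case True
      then have "{c. (m, p, c) \<in> N_u} = {1}"
        using False by (auto simp: N_u_iff)
      then have C: "(\<Sum>c | (m, p, c) \<in> N_u. b c * gvec k m c $ i) = b 1 * gvec k m 1 $ i" for b :: "nat \<Rightarrow> real" and i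
        by simp
      \<comment> \<open>The scale is read off from component 1 if its mode survives and from
        component 2 otherwise; admissibility makes the divisor nonzero in both cases.\<close>
      define t where "t = (if nu (m, p, c0) $ 1 = 1 then \<alpha> 1 / (K$3 + K$2) else \<alpha> 2 / (- K$1 - K$3))"
      have g: "gvec k m 1 $ 1 = K$3 + K$2" "gvec k m 1 $ 2 = - K$1 - K$3" "gvec k m 1 $ 3 = K$2 - K$1"
        unfolding K_def by (rule gvec_1)+
      have "\<alpha> 1 = t * (K$3 + K$2) * nu (m, p, c0) $ 1 \<and> \<alpha> 2 = t * (- K$1 - K$3) * nu (m, p, c0) $ 2
          \<and> \<alpha> 3 = t * (K$2 - K$1) * nu (m, p, c0) $ 3"
        using True False sup[of 1] sup[of 2] sup[of 3] div' K(2)[of 1] K(2)[of 2] K(2)[of 3]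
          K(3)[of 1] K(3)[of 2] K(3)[of 3]
        unfolding t_def vel_phases_eq vec3_nonzero_iff nu_eq
        by (cases "p$1"; cases "p$2"; cases "m$1 > 0"; cases "m$2 > 0"; cases "m$3 > 0")
          (simp_all add: field_simps)
      then have "\<alpha> i = t * gvec k m 1 $ i * nu (m, p, c0) $ i" for i
        using exhaust_3[of i] g by auto
      then show ?thesis
        unfolding C by (intro exI[of _ "\<lambda>_. t"]) auto
    next
      case not: False
      have "\<alpha> i = 0" for i
      proof (cases "m = 0")
        case False
        \<comment> \<open>An excluded phase leaves at most the component along the wave vector,
          which \<open>div'\<close> forces to be zero.\<close>
        then have "\<alpha> 1 = 0 \<and> \<alpha> 2 = 0 \<and> \<alpha> 3 = 0"
          using not sup[of 1] sup[of 2] sup[of 3] div' K(3)[of 1] K(3)[of 2] K(3)[of 3]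
          unfolding vel_phases_eq vec3_nonzero_iff nu_eq
          by (cases "p$1"; cases "p$2"; cases "m$1 > 0"; cases "m$2 > 0"; cases "m$3 > 0") simp_all
        then show ?thesis using exhaust_3[of i] by auto
      qed (use zero in auto)
      then show ?thesis
        by (intro exI[of _ "\<lambda>_. 0"]) simp
    qed
  qed
qed

text \<open>The scalar modes separate wave vectors and phases. Distinct \<open>c\<close> for the
  same wave vector occur only when all wave numbers are positive; there \<open>nu\<close> is 1 and
  the orthogonality of the two amplitude vectors decides.\<close>

lemma vel_mode_inner:
  assumes "n \<in> N_u" "n' \<in> N_u"
  shows "Omega_integral k (\<lambda>x. vel_mode k n x \<bullet> vel_mode k n' x) = of_bool (n = n')"
proof -
  obtain m p c m' p' c' where n: "n = (m, p, c)" "n' = (m', p', c')"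
    by (metis prod.exhaust)
  define A where "A = (\<lambda>m p c i. gvec k m c $ i * phase_sign p i / Gnu_norm k (m, p, c))"
  have pos: "Gnu_norm k (m, p, c) > 0" "Gnu_norm k (m', p', c') > 0"
    using Gnu_norm_pos assms n by auto
  have "Omega_integral k (\<lambda>x. vel_mode k n x \<bullet> vel_mode k n' x) =
     Omega_integral k (\<lambda>x. \<Sum>i\<in>UNIV. (A m p c i * A m' p' c' i) * (component_mode k i (m, p) x * component_mode k i (m', p') x))"
    by (simp add: n inner_vec_def vel_mode_nth A_def mult_ac)
  also have "\<dots> = (\<Sum>i\<in>UNIV. (A m p c i * A m' p' c' i) * (of_bool (m = m' \<and> p = p') * nu (m, p, c) $ i))"
    unfolding component_mode_inner[symmetric] Omega_integral_cmult[symmetric]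
    by (intro Omega_integral_sum continuous_intros)
  also have "\<dots> = of_bool (n = n')"
  proof (cases "m = m' \<and> p = p'")
    case True
    have A: "A m p c i * A m p c' i = gvec k m c $ i * gvec k m c' $ i / (Gnu_norm k (m, p, c) * Gnu_norm k (m, p, c'))" for i
    proof -
      have "A m p c i * A m p c' i = gvec k m c $ i * gvec k m c' $ i * (phase_sign p i * phase_sign p i)
          / (Gnu_norm k (m, p, c) * Gnu_norm k (m, p, c'))"
        unfolding A_def by (simp add: mult_ac del: phase_sign_sq)
      then show ?thesis by simp
    qed
    show ?thesis
    proof (cases "c = c'")
      case c: True
      have "(\<Sum>i\<in>UNIV. A m p c i * A m p c i * nu (m, p, c) $ i) =
          (\<Sum>i\<in>UNIV. (gvec k m c $ i)\<^sup>2 * nu (m, p, c) $ i) / (Gnu_norm k (m, p, c))\<^sup>2"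
        by (simp add: A[folded c] power2_eq_square sum_divide_distrib)
      also have "\<dots> = 1"
        unfolding Gnu_norm_sq[symmetric] using pos by simp
      finally show ?thesis using True c n by simp
    next
      case c: False
      then have m: "m$1 > 0" "m$2 > 0" "m$3 > 0" "c = 1 \<and> c' = 2 \<or> c = 2 \<and> c' = 1"
        using assms True unfolding n N_u_iff by auto
      have nu1: "nu (m, p, c) $ i = 1" for i
        using m exhaust_3[of i] by (auto simp: nu_eq)
      have "(\<Sum>i\<in>UNIV. gvec k m c $ i * gvec k m c' $ i) = 0"
        using m(4) gvec_orthogonal[of k m] by (auto simp: mult.commute)
      then have "(\<Sum>i\<in>UNIV. A m p c i * A m p c' i * nu (m, p, c) $ i) = 0"
        by (simp add: A nu1 sum_divide_distrib[symmetric])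
      then show ?thesis using True c n by simp
    qed
  qed (use n in auto)
  finally show ?thesis .
qed

lemma vel_temp_inner:
  "Omega_integral k (\<lambda>x. vel_mode k (m, p, c) x \<bullet> (temp_mode k (m', p', c') x *\<^sub>R axis 3 1))
    = Gmat k (m, p, c) $ 3 $ 3 * nu (m, p, c) $ 3 / Gnu_norm k (m, p, c) * of_bool (m = m') * of_bool (p = p')"
proof -
  have "phase_sign p 3 = 1" by (simp add: phase_sign_def phase_def)
  then have "Omega_integral k (\<lambda>x. vel_mode k (m, p, c) x \<bullet> (temp_mode k (m', p', c') x *\<^sub>R axis 3 1)) =
    Omega_integral k (\<lambda>x. (gvec k m c $ 3 / Gnu_norm k (m, p, c)) * (component_mode k 3 (m, p) x * component_mode k 3 (m', p') x))"
    unfolding temp_mode_eq by (simp add: inner_axis vel_mode_nth mult_ac)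
  also have "\<dots> = (gvec k m c $ 3 / Gnu_norm k (m, p, c)) * (of_bool (m = m' \<and> p = p') * nu (m, p, c) $ 3)"
    unfolding Omega_integral_cmult component_mode_inner[where c = c] ..
  finally show ?thesis
    by (simp add: Gmat_eq)
qed

text \<open>A scalar mode of component 1 is the one of component 2 with both phases flipped. This is
  the origin of the shifted Kronecker deltas in the rotation formula.\<close>

lemma component_phase_shift:
  "component_phase 1 p = component_phase 2 p' \<longleftrightarrow> p$1 + 1 = p'$1 \<and> p$2 + 1 = p'$2"
  by (cases "p$1"; cases "p$2"; cases "p'$1"; cases "p'$2")
     (auto simp: fun_eq_iff component_phase_def phase_def forall_3)

text \<open>When the indices match, both factors are the same function, so its squared norm is
  \<open>nu\<close> at either index. Both forms are needed to write the rotation formula with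
  \<open>nu (m, p, c)\<close> alone.\<close>

lemma component_mode_cross_inner:
  "Omega_integral k (\<lambda>x. component_mode k 1 (m, p) x * component_mode k 2 (m', p') x) =
    of_bool (m = m' \<and> p$1 + 1 = p'$1 \<and> p$2 + 1 = p'$2) * nu (m, p, c) $ 1"
  "Omega_integral k (\<lambda>x. component_mode k 1 (m, p) x * component_mode k 2 (m', p') x) =
    of_bool (m = m' \<and> p$1 + 1 = p'$1 \<and> p$2 + 1 = p'$2) * nu (m', p', c) $ 2"
  unfolding component_mode_def nu_nth fst_conv snd_conv component_phase_shift[symmetric]
  by (subst mode_orthogonality; auto)+

lemma vel_rotation_inner:
  "Omega_integral k (\<lambda>x. cross3 (axis 3 1) (vel_mode k (m', p', c') x) \<bullet> vel_mode k (m, p, c) x)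
    = (-1) ^ (of_bit (p$1) + of_bit (p$2))
      * (of_bool (m = m') * of_bool (p$1 + 1 = p'$1) * of_bool (p$2 + 1 = p'$2)
         / (Gnu_norm k (m', p', c') * Gnu_norm k (m, p, c)))
      * (Gmat k (m', p', c') $ 2 $ 2 * Gmat k (m, p, c) $ 1 $ 1 * nu (m, p, c) $ 1
         - Gmat k (m', p', c') $ 1 $ 1 * Gmat k (m, p, c) $ 2 $ 2 * nu (m, p, c) $ 2)"
proof -
  define A where "A = (\<lambda>m p c i. gvec k m c $ i * phase_sign p i / Gnu_norm k (m, p, c))"
  define B where "B \<longleftrightarrow> m = m' \<and> p$1 + 1 = p'$1 \<and> p$2 + 1 = p'$2"
  have B': "m' = m \<and> p'$1 + 1 = p$1 \<and> p'$2 + 1 = p$2 \<longleftrightarrow> B"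
    unfolding B_def by (cases "p$1"; cases "p$2"; cases "p'$1"; cases "p'$2") auto
  have "Omega_integral k (\<lambda>x. cross3 (axis 3 1) (vel_mode k (m', p', c') x) \<bullet> vel_mode k (m, p, c) x) =
     Omega_integral k (\<lambda>x. (A m' p' c' 1 * A m p c 2) * (component_mode k 1 (m', p') x * component_mode k 2 (m, p) x)
       - (A m' p' c' 2 * A m p c 1) * (component_mode k 1 (m, p) x * component_mode k 2 (m', p') x))"
    by (simp add: inner_vec_def sum_3 cross3_def axis_def vel_mode_nth A_def mult_ac)
  also have "\<dots> = (A m' p' c' 1 * A m p c 2) * (of_bool B * nu (m, p, c) $ 2) - (A m' p' c' 2 * A m p c 1) * (of_bool B * nu (m, p, c) $ 1)"
    by (subst Omega_integral_diff)
       (auto intro!: continuous_intros simp: Omega_integral_cmult component_mode_cross_inner(1)[where p = p and c = c]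
         component_mode_cross_inner(2)[where p' = p and c = c] B_def[symmetric] B' simp del: mult_cancel_left)
  also have "\<dots> = (-1) ^ (of_bit (p$1) + of_bit (p$2))
      * (of_bool B / (Gnu_norm k (m', p', c') * Gnu_norm k (m, p, c)))
      * (gvec k m' c' $ 2 * gvec k m c $ 1 * nu (m, p, c) $ 1 - gvec k m' c' $ 1 * gvec k m c $ 2 * nu (m, p, c) $ 2)"
  proof (cases B)
    case True
    then have p': "p'$1 = p$1 + 1" "p'$2 = p$2 + 1" by (auto simp: B_def)
    \<comment> \<open>Flipping both phases gives either product the sign opposite to the one in the
      claim; this minus exchanges the two terms of the difference.\<close>
    have s: "phase_sign p' 1 * phase_sign p 2 = - ((-1) ^ (of_bit (p$1) + of_bit (p$2)))"
      "phase_sign p' 2 * phase_sign p 1 = - ((-1) ^ (of_bit (p$1) + of_bit (p$2)))"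
      unfolding phase_sign_def phase_def p'
      by (cases "p$1"; cases "p$2"; simp)+
    have A: "A m' p' c' i * A m p c j = gvec k m' c' $ i * gvec k m c $ j * (phase_sign p' i * phase_sign p j)
        / (Gnu_norm k (m', p', c') * Gnu_norm k (m, p, c))" for i j
      by (simp add: A_def mult_ac)
    show ?thesis
      unfolding A s using True by (simp add: divide_simps)
  qed simp
  finally show ?thesis
    unfolding Gmat_eq B_def by (simp add: mult_ac)
qed

end

section \<open>Differential properties and completeness of the velocity modes\<close>

lemma vel_mode_eq_sum:
  "vel_mode k (m, p, c) = (\<lambda>x. \<Sum>i\<in>UNIV. trig_prod k m (component_phase i p) x *\<^sub>R
     ((gvec k m c $ i * phase_sign p i / Gnu_norm k (m, p, c) * (eta m / Vconst)) *\<^sub>R axis i 1))"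
proof
  fix x
  show "vel_mode k (m, p, c) x = (\<Sum>i\<in>UNIV. trig_prod k m (component_phase i p) x *\<^sub>R
     ((gvec k m c $ i * phase_sign p i / Gnu_norm k (m, p, c) * (eta m / Vconst)) *\<^sub>R axis i 1))"
    by (simp add: vec_eq_iff forall_3 sum_3 vel_mode_nth component_mode_def axis_def)
qed

lemma component_phase_flip: "(component_phase j p)(j := component_phase j p j + 1) = phase p"
proof -
  have "(a::bit) + 1 + 1 = a" for a by (cases a) auto
  then show ?thesis by (auto simp: component_phase_def fun_eq_iff)
qed

text \<open>The partial derivatives of the product with phases \<open>phase p\<close> are multiples
  of the scalar modes of the three components, which makes it the test function for the
  divergence.\<close>

lemma phase_flip: "(phase p)(j := phase p j + 1) = component_phase j p"
  by (auto simp: component_phase_def fun_eq_iff)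

lemma minus_one_power_of_bit_Suc: "(-1) ^ of_bit (b + 1) = - ((-1) ^ of_bit b :: real)"
  by (cases b) auto

lemma sum_axis: "(\<Sum>i\<in>UNIV. axis j (1::real) $ i * f i) = f j"
  by (subst sum.remove[of _ j]) (auto simp: axis_def intro!: sum.neutral)

context layer begin

lemma vel_mode_has_derivative:
  obtains J where "\<And>S. (vel_mode k (m, p, c) has_derivative J) (at x within S)"
    "\<And>h i. J h $ i = gvec k m c $ i * phase_sign p i / Gnu_norm k (m, p, c) * (eta m / Vconst) *
       (\<Sum>j\<in>UNIV. h$j * ((-1) ^ of_bit (component_phase i p j + 1) * wave k m $ j *
         trig_prod k m ((component_phase i p)(j := component_phase i p j + 1)) x))"
proof
  let ?J = "\<lambda>h. \<Sum>i\<in>UNIV. (\<Sum>j\<in>UNIV. h$j * ((-1) ^ of_bit (component_phase i p j + 1) * (k$j * real (m$j)) *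
         trig_prod k m ((component_phase i p)(j := component_phase i p j + 1)) x)) *\<^sub>R
      ((gvec k m c $ i * phase_sign p i / Gnu_norm k (m, p, c) * (eta m / Vconst)) *\<^sub>R axis i (1::real))"
  show "(vel_mode k (m, p, c) has_derivative ?J) (at x within S)" for S
    unfolding vel_mode_eq_sum
    by (intro has_derivative_sum has_derivative_scaleR_left trig_prod_has_derivative)
  show "?J h $ i = gvec k m c $ i * phase_sign p i / Gnu_norm k (m, p, c) * (eta m / Vconst) *
       (\<Sum>j\<in>UNIV. h$j * ((-1) ^ of_bit (component_phase i p j + 1) * wave k m $ j *
         trig_prod k m ((component_phase i p)(j := component_phase i p j + 1)) x))" for h i
  proof -
    have "(\<Sum>l\<in>UNIV. s l *\<^sub>R (a l *\<^sub>R axis l (1::real))) $ i = a i * s i" for s a :: "3 \<Rightarrow> real"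
      using exhaust_3[of i] by (auto simp: sum_3 axis_def)
    then show ?thesis unfolding wave_nth .
  qed
qed

lemma vel_mode_divergence_free: "divergence_free k (vel_mode k n)"
  unfolding divergence_free_def
proof
  fix x
  obtain m p c where n: "n = (m, p, c)" by (metis prod.exhaust)
  obtain J where J: "\<And>S. (vel_mode k (m, p, c) has_derivative J) (at x within S)"
    "\<And>h i. J h $ i = gvec k m c $ i * phase_sign p i / Gnu_norm k (m, p, c) * (eta m / Vconst) *
       (\<Sum>j\<in>UNIV. h$j * ((-1) ^ of_bit (component_phase i p j + 1) * wave k m $ j *
         trig_prod k m ((component_phase i p)(j := component_phase i p j + 1)) x))"
    using vel_mode_has_derivative[of m p c x] by blast
  have "(a::bit) + 1 + 1 = a" for a by (cases a) auto
  then have sgn: "(-1) ^ of_bit (component_phase j p j + 1) = phase_sign p j" for j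
    by (simp add: component_phase_def phase_sign_def)
  have "J (axis j 1) $ j = (eta m / Vconst) / Gnu_norm k (m, p, c) * trig_prod k m (phase p) x *
      (phase_sign p j * phase_sign p j) * (gvec k m c $ j * wave k m $ j)" for j
    unfolding J(2) sum_axis component_phase_flip sgn by (simp add: mult_ac del: phase_sign_sq wave_nth)
  then have "(\<Sum>j\<in>UNIV. J (axis j 1) $ j) = (eta m / Vconst) / Gnu_norm k (m, p, c) * trig_prod k m (phase p) x *
      (\<Sum>j\<in>UNIV. gvec k m c $ j * wave k m $ j)"
    unfolding sum_distrib_left by (simp del: wave_nth)
  then show "\<exists>J. (vel_mode k n has_derivative J) (at x within slab k) \<and> (\<Sum>i\<in>UNIV. J (axis i 1) $ i) = 0"
    unfolding gvec_orthogonal_wave n using J(1) by auto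
qed

lemma trig_prod_walls: "x \<in> walls k \<Longrightarrow> q 3 = 1 \<Longrightarrow> trig_prod k m q x = 0"
  using k_pos[of 3] by (auto simp: trig_prod_def prod_3 walls_def trig_def)

lemma vel_mode_velocity_bc: "velocity_bc k (vel_mode k n)"
  unfolding velocity_bc_def
proof
  fix x assume x: "x \<in> walls k"
  obtain m p c where n: "n = (m, p, c)" by (metis prod.exhaust)
  obtain J where J: "\<And>S. (vel_mode k (m, p, c) has_derivative J) (at x within S)"
    "\<And>h i. J h $ i = gvec k m c $ i * phase_sign p i / Gnu_norm k (m, p, c) * (eta m / Vconst) *
       (\<Sum>j\<in>UNIV. h$j * ((-1) ^ of_bit (component_phase i p j + 1) * wave k m $ j *
         trig_prod k m ((component_phase i p)(j := component_phase i p j + 1)) x))"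
    using vel_mode_has_derivative[of m p c x] by blast
  \<comment> \<open>For \<open>i \<noteq> 3\<close> the x_3 factor is a cosine; its derivative is a
    multiple of a sine that vanishes on the walls.\<close>
  have "J (axis 3 1) $ i = 0" if "i \<noteq> 3" for i
    unfolding J(2) sum_axis using trig_prod_walls[OF x] that by simp
  then have "J (axis 3 1) $ 1 = 0" "J (axis 3 1) $ 2 = 0" by simp_all
  moreover have "vel_mode k n x $ 3 = 0"
    unfolding n vel_mode_nth using component_mode_walls[OF x] by simp
  ultimately show "vel_mode k n x $ 3 = 0 \<and> (\<exists>J. (vel_mode k n has_derivative J) (at x within slab k) \<and>
      J (axis 3 1) $ 1 = 0 \<and> J (axis 3 1) $ 2 = 0)"
    using J(1) n by blast
qed

lemma component_mode_mean:
  assumes "m \<noteq> 0" "i \<noteq> 3"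
  shows "Omega_integral k (component_mode k i (m, p)) = 0"
proof -
  \<comment> \<open>The second factor is the constant 1. Its x_3 phase is 0, so the orthogonality
    relation covers exactly the components with cosines in x_3.\<close>
  have "Omega_integral k (\<lambda>x. trig_prod k m (component_phase i p) x * trig_prod k 0 (\<lambda>_. 0) x) = 0"
    using assms by (subst trig_prod_orthogonality) auto
  then have "Omega_integral k (trig_prod k m (component_phase i p)) = 0"
    by (simp add: trig_prod_def[of k 0])
  then have "eta m / Vconst * Omega_integral k (trig_prod k m (component_phase i p)) = 0"
    by simp
  then show ?thesis
    unfolding component_mode_def[abs_def] Omega_integral_cmult[symmetric] by simp
qed

lemma continuous_on_vel_mode: "continuous_on S (vel_mode k n)"
  by (cases n) (simp only: vel_mode_eq_sum, intro continuous_intros)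

lemma vel_mode_in_L2_sigma:
  assumes "n \<in> N_u"
  shows "vel_mode k n \<in> L2_sigma k"
proof -
  obtain m p c where n: "n = (m, p, c)" by (metis prod.exhaust)
  have m: "m \<noteq> 0" using assms by (simp add: n N_u_iff)
  have "smooth_on (slab k) (vel_mode k n)"
    unfolding n vel_mode_eq_sum by (rule smooth_on_sum_trig_prod)
  moreover have "horizontally_periodic k (vel_mode k n)"
    unfolding n horizontally_periodic_def by (simp add: vec_eq_iff vel_mode_nth component_mode_shift)
  moreover have "Omega_integral k (\<lambda>x. vel_mode k n x $ i) = 0" if "i \<noteq> 3" for i
    unfolding n vel_mode_nth Omega_integral_cmult component_mode_mean[OF m that] by simp
  then have "Omega_integral k (\<lambda>x. vel_mode k n x $ 1) = 0" "Omega_integral k (\<lambda>x. vel_mode k n x $ 2) = 0"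
    by simp_all
  ultimately show ?thesis
    unfolding L2_sigma_def
    by (intro L2_closure_superset L2_continuous continuous_on_vel_mode CollectI conjI
        vel_mode_divergence_free vel_mode_velocity_bc)
qed

text \<open>Uniqueness of the derivative within the slab needs nearby points in every coordinate
  direction, also at the walls; \<open>d\<close> is signed to point away from the nearer
  wall.\<close>

lemma slab_approachable:
  assumes "x \<in> slab k" "i \<in> Basis" "e > 0"
  shows "\<exists>d. 0 < \<bar>d\<bar> \<and> \<bar>d\<bar> < e \<and> x + d *\<^sub>R i \<in> slab k"
proof -
  obtain j where j: "i = axis j 1" using assms(2) by (auto simp: Basis_vec_def)
  define h where "h = pi / k$3"
  have h: "h > 0" using k_pos[of 3] by (simp add: h_def)
  define d where "d = (if x$3 < h / 2 then min (e / 2) (h / 2) else - min (e / 2) (h / 2))"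
  have "0 < \<bar>d\<bar> \<and> \<bar>d\<bar> < e" using assms(3) h by (auto simp: d_def)
  moreover have "0 \<le> x$3" "x$3 \<le> h" using assms(1) by (auto simp: slab_def h_def)
  then have "0 \<le> x$3 + d" "x$3 + d \<le> h"
    using h assms(3) by (auto simp: d_def min_def)
  with assms(1) have "x + d *\<^sub>R i \<in> slab k"
    by (auto simp: slab_def j axis_def h_def[symmetric])
  ultimately show ?thesis by blast
qed

text \<open>Integration by parts of div w = 0 against the product with phases
  \<open>phase p\<close>. Boundary terms cancel by periodicity in directions 1 and 2 and by the
  vanishing third component on the walls.\<close>

lemma divergence_coefficients:
  assumes sm: "smooth_on (slab k) w" and per: "horizontally_periodic k w"
    and div: "divergence_free k w" and walls: "\<And>x. x \<in> walls k \<Longrightarrow> w x $ 3 = 0"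
  shows "(\<Sum>i\<in>UNIV. phase_sign p i * Omega_integral k (\<lambda>x. w x $ i * component_mode k i (m, p) x) * wave k m $ i) = 0"
proof -
  obtain D where D: "\<And>x. x \<in> slab k \<Longrightarrow> (w has_derivative (\<lambda>h. \<Sum>i\<in>UNIV. h$i *\<^sub>R D i x)) (at x within slab k)"
    and smD: "\<And>i. smooth_on (slab k) (D i)"
    using sm by (cases rule: smooth_on.cases) blast
  have contw: "continuous_on (slab k) w" and contD: "continuous_on (slab k) (D i)" for i
    using sm smD smooth_on_imp_continuous_on by auto
  have divD: "(\<Sum>i\<in>UNIV. D i x $ i) = 0" if x: "x \<in> slab k" for x
  proof -
    obtain J where J: "(w has_derivative J) (at x within slab k)" "(\<Sum>i\<in>UNIV. J (axis i 1) $ i) = 0"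
      using div x unfolding divergence_free_def by blast
    \<comment> \<open>\<open>smooth_on\<close> and \<open>divergence_free\<close> each supply a
      derivative; uniqueness within the slab identifies them.\<close>
    have "J = (\<lambda>h. \<Sum>i\<in>UNIV. h$i *\<^sub>R D i x)"
      by (rule frechet_derivative_unique_within[OF J(1) D[OF x]]) (use slab_approachable[OF x] in blast)
    moreover have "(\<Sum>i\<in>UNIV. axis j (1::real) $ i *\<^sub>R D i x) = D j x" for j
      by (subst sum.remove[of _ j]) (auto simp: axis_def intro!: sum.neutral)
    ultimately show ?thesis using J(2) by simp
  qed
  define \<phi> where "\<phi> = trig_prod k m (phase p)"
  define \<phi>' where "\<phi>' = (\<lambda>i x. - (phase_sign p i * wave k m $ i * trig_prod k m (component_phase i p) x))"
  have \<phi>_deriv: "(\<phi> has_derivative (\<lambda>h. \<Sum>i\<in>UNIV. h$i * \<phi>' i x)) (at x within S)" for x S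
    using trig_prod_has_derivative[of k m "phase p" x S]
    unfolding \<phi>_def \<phi>'_def phase_flip minus_one_power_of_bit_Suc phase_sign_def[symmetric] by simp
  have cont\<phi>: "continuous_on S \<phi>" "continuous_on S (\<phi>' i)" for S i
    unfolding \<phi>_def \<phi>'_def by (intro continuous_intros)+
  have contO: "continuous_on (Omega k) w" "continuous_on (Omega k) (D i)" for i
    using contw contD Omega_subset_slab continuous_on_subset by blast+
  have cont_nth: "continuous_on S (\<lambda>x. u x $ i)" if "continuous_on S u" for S and u :: "real^3 \<Rightarrow> real^3" and i
    using that by (intro continuous_intros)
  have parts: "Omega_integral k (\<lambda>x. D j x $ j * \<phi> x) = - Omega_integral k (\<lambda>x. w x $ j * \<phi>' j x)" for j
  proof -
    define E where "E = (\<lambda>i x. D i x $ j * \<phi> x + w x $ j * \<phi>' i x)"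
    have "Omega_integral k (E j) = 0"
    proof (rule Omega_integral_partial_zero[where g = "\<lambda>x. w x $ j * \<phi> x"])
      fix x assume x: "x \<in> slab k"
      have "((\<lambda>x. w x $ j) has_derivative (\<lambda>h. (\<Sum>i\<in>UNIV. h$i *\<^sub>R D i x) $ j)) (at x within slab k)"
        using D[OF x] by (rule bounded_linear.has_derivative[OF bounded_linear_vec_nth])
      from has_derivative_mult[OF this \<phi>_deriv]
      show "((\<lambda>x. w x $ j * \<phi> x) has_derivative (\<lambda>h. \<Sum>i\<in>UNIV. h$i * E i x)) (at x within slab k)"
        by (rule has_derivative_eq_rhs)
           (simp add: fun_eq_iff E_def distrib_left sum.distrib sum_distrib_left sum_distrib_right mult_ac)
    next
      show "continuous_on (slab k) (E j)"
        unfolding E_def by (intro continuous_intros cont_nth contw contD cont\<phi>)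
    next
      fix x assume x: "x \<in> Omega k" "x $ j = 0"
      show "w (x + axis j (corner $ j)) $ j * \<phi> (x + axis j (corner $ j)) = w x $ j * \<phi> x"
      proof (cases "j = 3")
        case True
        then have "x \<in> walls k" "x + axis j (corner $ j) \<in> walls k"
          using x by (auto simp: walls_def axis_def)
        then show ?thesis using walls True by simp
      next
        case False
        then have j: "j = 1 \<or> j = 2" using exhaust_3[of j] by auto
        then have c: "corner $ j = 2 * pi / k$j" by auto
        have "w (x + axis j (2 * pi / k$j)) = w x"
          using j per x Omega_subset_slab unfolding horizontally_periodic_def by auto
        then show ?thesis
          using trig_prod_shift[OF j] unfolding c \<phi>_def by simp
      qed
    qed
    moreover have "Omega_integral k (E j) = Omega_integral k (\<lambda>x. D j x $ j * \<phi> x) + Omega_integral k (\<lambda>x. w x $ j * \<phi>' j x)"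
      unfolding E_def by (intro Omega_integral_add continuous_intros cont_nth contO cont\<phi>)
    ultimately show ?thesis by simp
  qed
  have "(\<Sum>j\<in>UNIV. Omega_integral k (\<lambda>x. D j x $ j * \<phi> x)) = Omega_integral k (\<lambda>x. \<Sum>j\<in>UNIV. D j x $ j * \<phi> x)"
    by (intro Omega_integral_sum[symmetric] continuous_intros cont_nth contO cont\<phi>)
  also have "\<dots> = Omega_integral k (\<lambda>x. 0)"
    using divD Omega_subset_slab by (intro Omega_integral_cong) (auto simp flip: sum_distrib_right)
  also have "\<dots> = 0" by (simp add: Omega_integral_def)
  finally have 0: "(\<Sum>j\<in>UNIV. Omega_integral k (\<lambda>x. w x $ j * \<phi>' j x)) = 0"
    unfolding parts sum_negf by simp
  have "phase_sign p j * Omega_integral k (\<lambda>x. w x $ j * component_mode k j (m, p) x) * wave k m $ j =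
      - (eta m / Vconst) * Omega_integral k (\<lambda>x. w x $ j * \<phi>' j x)" for j
  proof -
    have "Omega_integral k (\<lambda>x. w x $ j * component_mode k j (m, p) x) * (phase_sign p j * wave k m $ j) =
        Omega_integral k (\<lambda>x. (phase_sign p j * wave k m $ j) * (w x $ j * component_mode k j (m, p) x))"
      unfolding Omega_integral_cmult by simp
    also have "\<dots> = Omega_integral k (\<lambda>x. - (eta m / Vconst) * (w x $ j * \<phi>' j x))"
      by (intro Omega_integral_cong) (simp add: \<phi>'_def component_mode_def mult_ac)
    finally show ?thesis
      unfolding Omega_integral_cmult by (simp add: mult_ac)
  qed
  then have "(\<Sum>i\<in>UNIV. phase_sign p i * Omega_integral k (\<lambda>x. w x $ i * component_mode k i (m, p) x) * wave k m $ i) =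
     - (eta m / Vconst) * (\<Sum>j\<in>UNIV. Omega_integral k (\<lambda>x. w x $ j * \<phi>' j x))"
    by (simp add: sum_distrib_left)
  then show ?thesis using 0 by simp
qed

text \<open>At wave vector zero each scalar mode is constant, and zero for component 3, so only the
  two horizontal means enter.\<close>

lemma zero_wave_coefficient:
  assumes "Omega_integral k (\<lambda>x. w x $ 1) = 0" "Omega_integral k (\<lambda>x. w x $ 2) = (0::real)"
  shows "Omega_integral k (\<lambda>x. w x $ i * component_mode k i (0, p) x) = 0"
proof (cases "nu (0, p, 1) $ i = 0")
  case True
  then show ?thesis
    using component_mode_eq_0[OF True] by (simp add: Omega_integral_def)
next
  case False
  then have i: "i = 1 \<or> i = 2" using exhaust_3[of i] by (auto simp: nu_eq)
  have "component_mode k i (0, p) x = eta 0 / Vconst * (\<Prod>j\<in>UNIV. of_bool (component_phase i p j = 0))" for x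
    by (simp add: component_mode_def trig_prod_def)
  then have "Omega_integral k (\<lambda>x. w x $ i * component_mode k i (0, p) x) =
     eta 0 / Vconst * (\<Prod>j\<in>UNIV. of_bool (component_phase i p j = 0)) * Omega_integral k (\<lambda>x. w x $ i)"
    unfolding Omega_integral_cmult[symmetric] by (simp add: mult_ac)
  then show ?thesis using i assms by auto
qed

lemma modal_projection_span:
  assumes sm: "smooth_on (slab k) w" and per: "horizontally_periodic k w"
    and div: "divergence_free k w" and bc: "velocity_bc k w"
    and mean: "Omega_integral k (\<lambda>x. w x $ 1) = 0" "Omega_integral k (\<lambda>x. w x $ 2) = 0"
  shows "\<exists>b. \<forall>i x. Omega_integral k (\<lambda>x. w x $ i * component_mode k i (m, p) x) * component_mode k i (m, p) x =
    (\<Sum>c | (m, p, c) \<in> N_u. b c * vel_mode k (m, p, c) x $ i)"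
proof -
  define C where "C = {c. (m, p, c) \<in> N_u}"
  define cf where "cf = (\<lambda>i. Omega_integral k (\<lambda>x. w x $ i * component_mode k i (m, p) x))"
  \<comment> \<open>With this sign, \<open>divergence_coefficients\<close> becomes orthogonality to
    the wave vector; the equal sign in \<open>vel_mode_nth\<close> removes it again.\<close>
  define \<alpha> where "\<alpha> = (\<lambda>i. phase_sign p i * cf i)"
  have nu0: "cf i = 0" if "nu (m, p, 1) $ i = 0" for i
    using component_mode_eq_0[OF that] by (simp add: cf_def Omega_integral_def)
  have "\<exists>b. \<forall>i. \<alpha> i = (\<Sum>c | (m, p, c) \<in> N_u. b c * gvec k m c $ i) * nu (m, p, 1) $ i"
  proof (rule amplitude_span)
    show "(\<Sum>i\<in>UNIV. \<alpha> i * wave k m $ i) = 0"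
      unfolding \<alpha>_def cf_def using bc
      by (intro divergence_coefficients sm per div) (simp add: velocity_bc_def)
  qed (use nu0 zero_wave_coefficient[OF mean] in \<open>auto simp: \<alpha>_def cf_def\<close>)
  then obtain b where b: "\<And>i. \<alpha> i = (\<Sum>c\<in>C. b c * gvec k m c $ i) * nu (m, p, 1) $ i"
    unfolding C_def by blast
  \<comment> \<open>The factor \<open>Gnu_norm\<close> undoes the normalisation of the velocity
    modes; it is positive for every \<open>c\<close> in \<open>C\<close>.\<close>
  have "cf i * component_mode k i (m, p) x = (\<Sum>c\<in>C. (b c * Gnu_norm k (m, p, c)) * vel_mode k (m, p, c) x $ i)" for i x
  proof -
    have nu: "nu (m, p, 1) $ i * component_mode k i (m, p) x = component_mode k i (m, p) x"
      using nu_cases[of m p 1 i] component_mode_eq_0[of m p 1 i k x] by auto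
    have "(b c * Gnu_norm k (m, p, c)) * vel_mode k (m, p, c) x $ i =
        b c * gvec k m c $ i * (phase_sign p i * component_mode k i (m, p) x)" if "c \<in> C" for c
      using Gnu_norm_pos[of m p c] that unfolding vel_mode_nth C_def by simp
    then have "(\<Sum>c\<in>C. (b c * Gnu_norm k (m, p, c)) * vel_mode k (m, p, c) x $ i) =
        (\<Sum>c\<in>C. b c * gvec k m c $ i) * (phase_sign p i * component_mode k i (m, p) x)"
      unfolding sum_distrib_right by (intro sum.cong) auto
    also have "\<dots> = phase_sign p i * \<alpha> i * component_mode k i (m, p) x"
      unfolding b by (subst (1) nu[symmetric]) (simp only: mult_ac)
    also have "\<dots> = cf i * component_mode k i (m, p) x"
      unfolding \<alpha>_def by (simp flip: mult.assoc)
    finally show ?thesis by simp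
  qed
  then show ?thesis
    unfolding cf_def C_def by (intro exI[of _ "\<lambda>c. b c * Gnu_norm k (m, p, c)"]) auto
qed

lemma vel_mode_dense:
  assumes sm: "smooth_on (slab k) w" and per: "horizontally_periodic k w"
    and div: "divergence_free k w" and bc: "velocity_bc k w"
    and mean: "Omega_integral k (\<lambda>x. w x $ 1) = 0" "Omega_integral k (\<lambda>x. w x $ 2) = 0"
    and \<epsilon>: "\<epsilon> > 0"
  shows "\<exists>F a. finite F \<and> F \<subseteq> N_u \<and> L2_norm k (\<lambda>x. w x - (\<Sum>n\<in>F. a n *\<^sub>R vel_mode k n x)) < \<epsilon>"
proof -
  define cf where "cf = (\<lambda>i n. Omega_integral k (\<lambda>x. w x $ i * component_mode k i n x))"
  have contw: "continuous_on (slab k) (\<lambda>x. w x $ i)" for i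
    using smooth_on_imp_continuous_on[OF sm] by (intro continuous_intros)
  then have contO: "continuous_on (Omega k) (\<lambda>x. w x $ i)" for i
    using Omega_subset_slab continuous_on_subset by blast
  define P where "P = (\<lambda>i F a. finite F \<and>
    Omega_integral k (\<lambda>x. (w x $ i - (\<Sum>n\<in>F. a n * component_mode k i n x))\<^sup>2) \<le> \<epsilon>\<^sup>2 / 4)"
  have "\<exists>F a. P i F a" for i
    unfolding P_def using per bc \<epsilon>
    by (intro component_mode_approx contw) (auto simp: horizontally_periodic_def velocity_bc_def)
  then obtain F a where "\<And>i. P i (F i) (a i)"
    by metis
  then have F: "finite (F i)"
      "Omega_integral k (\<lambda>x. (w x $ i - (\<Sum>n\<in>F i. a i n * component_mode k i n x))\<^sup>2) \<le> \<epsilon>\<^sup>2 / 4" for i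
    by (auto simp: P_def)
  \<comment> \<open>Velocity modes can only be assembled from the coefficients of all three
    components at an index, so the three sets are merged; \<open>projection_minimal\<close> shows
    that enlarging a set does not increase the error.\<close>
  define F' where "F' = (\<Union>i\<in>UNIV. F i)"
  have F': "finite F'" using F by (simp add: F'_def)
  have proj: "Omega_integral k (\<lambda>x. (w x $ i - (\<Sum>n\<in>F'. cf i n * component_mode k i n x))\<^sup>2) \<le> \<epsilon>\<^sup>2 / 4" for i
  proof -
    have "Omega_integral k (\<lambda>x. (w x $ i - (\<Sum>n\<in>F'. cf i n * component_mode k i n x))\<^sup>2) \<le>
        Omega_integral k (\<lambda>x. (w x $ i - (\<Sum>n\<in>F i. a i n * component_mode k i n x))\<^sup>2)"
      unfolding cf_def
    proof (rule projection_minimal[where N = "\<lambda>n. nu (fst n, snd n, 1) $ i"])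
      fix n n' :: "(nat^3) \<times> (bit^2)"
      show "Omega_integral k (\<lambda>x. component_mode k i n x * component_mode k i n' x) =
          of_bool (n = n') * nu (fst n, snd n, 1) $ i"
        using component_mode_inner[of i "fst n" "snd n" "fst n'" "snd n'" 1] by (simp add: prod_eq_iff)
      show "Omega_integral k (\<lambda>x. w x $ i * component_mode k i n x) * nu (fst n, snd n, 1) $ i =
          Omega_integral k (\<lambda>x. w x $ i * component_mode k i n x)"
        using nu_cases[of "fst n" "snd n" 1 i] component_mode_eq_0[of "fst n" "snd n" 1 i]
        by (auto simp: Omega_integral_def)
    qed (use F(1) in \<open>auto intro!: contO continuous_intros simp: F'_def\<close>)
    then show ?thesis using F(2)[of i] by linarith
  qed
  have "\<exists>b. \<forall>n i x. cf i n * component_mode k i n x =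
      (\<Sum>c | (fst n, snd n, c) \<in> N_u. b n c * vel_mode k (fst n, snd n, c) x $ i)"
  proof (rule choice, rule allI)
    fix n
    show "\<exists>b. \<forall>i x. cf i n * component_mode k i n x =
        (\<Sum>c | (fst n, snd n, c) \<in> N_u. b c * vel_mode k (fst n, snd n, c) x $ i)"
      using modal_projection_span[OF sm per div bc mean, of "fst n" "snd n"] by (simp add: cf_def)
  qed
  then obtain b where b: "\<And>n i x. cf i n * component_mode k i n x =
      (\<Sum>c | (fst n, snd n, c) \<in> N_u. b n c * vel_mode k (fst n, snd n, c) x $ i)"
    by blast
  define C where "C = (\<lambda>n :: (nat^3) \<times> (bit^2). {c. (fst n, snd n, c) \<in> N_u})"
  have finC: "finite (C n)" for n
    by (rule finite_subset[of _ "{1, 2}"]) (auto simp: C_def N_u_iff)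
  define h where "h = (\<lambda>(n :: (nat^3) \<times> (bit^2), c :: nat). (fst n, snd n, c))"
  have inj: "inj_on h A" for A by (auto simp: inj_on_def h_def)
  define G where "G = h ` Sigma F' C"
  define d where "d = (\<lambda>(m, p, c). b (m, p) c)"
  have G: "finite G" "G \<subseteq> N_u"
    using F' finC by (auto simp: G_def h_def C_def)
  have sumG: "(\<Sum>n\<in>G. d n *\<^sub>R vel_mode k n x) $ i = (\<Sum>n\<in>F'. cf i n * component_mode k i n x)" for x i
  proof -
    have "(\<Sum>n\<in>G. d n *\<^sub>R vel_mode k n x) $ i = (\<Sum>(n, c)\<in>Sigma F' C. b n c * vel_mode k (fst n, snd n, c) x $ i)"
      unfolding G_def sum_component by (subst sum.reindex[OF inj]) (auto simp: h_def d_def intro!: sum.cong)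
    also have "\<dots> = (\<Sum>n\<in>F'. \<Sum>c\<in>C n. b n c * vel_mode k (fst n, snd n, c) x $ i)"
      using F' finC by (subst sum.Sigma) auto
    finally show ?thesis by (simp add: b C_def)
  qed
  have "Omega_integral k (\<lambda>x. (norm (w x - (\<Sum>n\<in>G. d n *\<^sub>R vel_mode k n x)))\<^sup>2) =
      Omega_integral k (\<lambda>x. \<Sum>i\<in>UNIV. (w x $ i - (\<Sum>n\<in>F'. cf i n * component_mode k i n x))\<^sup>2)"
    unfolding power2_norm_eq_inner inner_vec_def vector_minus_component sumG inner_real_def
    by (simp only: power2_eq_square)
  also have "\<dots> = (\<Sum>i\<in>UNIV. Omega_integral k (\<lambda>x. (w x $ i - (\<Sum>n\<in>F'. cf i n * component_mode k i n x))\<^sup>2))"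
    by (intro Omega_integral_sum continuous_intros contO)
  also have "\<dots> < \<epsilon>\<^sup>2"
    using proj[of 1] proj[of 2] proj[of 3] zero_less_power[OF \<epsilon>, of 2] unfolding sum_3 by linarith
  finally have "L2_norm k (\<lambda>x. w x - (\<Sum>n\<in>G. d n *\<^sub>R vel_mode k n x)) < \<epsilon>"
    using \<epsilon> by (simp add: L2_norm_less_iff)
  then show ?thesis using G by blast
qed

lemma vel_mode_orthonormal_basis: "orthonormal_basis k (L2_sigma k) N_u (vel_mode k)"
  unfolding orthonormal_basis_def
proof (intro conjI ballI allI impI)
  show "vel_mode k n \<in> L2_sigma k" if "n \<in> N_u" for n using that by (rule vel_mode_in_L2_sigma)
  show "L2_inner k (vel_mode k n) (vel_mode k n') = of_bool (n = n')" if "n \<in> N_u" "n' \<in> N_u" for n n'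
    using vel_mode_inner[OF that] by (simp add: L2_inner_def)
  show "\<exists>F a. finite F \<and> F \<subseteq> N_u \<and> L2_norm k (\<lambda>x. u x - (\<Sum>n\<in>F. a n *\<^sub>R vel_mode k n x)) < \<epsilon>"
    if "u \<in> L2_sigma k" "\<epsilon> > 0" for u \<epsilon>
    using that(1) unfolding L2_sigma_def
  proof (rule L2_closure_dense[rotated 2])
    show "continuous_on (Omega k) (vel_mode k n)" for n by (rule continuous_on_vel_mode)
  qed (use vel_mode_dense that(2) in auto)
qed

end

theorem proposition2p1:
  fixes k :: "real^3"
  assumes "0 < k$1" and "0 < k$2" and "k$3 = inverse (k$1 * k$2)"
  shows
    "(\<forall>n\<in>N_u. divergence_free k (vel_mode k n) \<and> velocity_bc k (vel_mode k n))
     \<and> orthonormal_basis k (L2_0 k) N_theta (temp_mode k)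
     \<and> orthonormal_basis k (L2_sigma k) N_u (vel_mode k)
     \<and> (\<forall>n\<in>N_theta. \<forall>n'\<in>N_theta.
          Omega_integral k (\<lambda>x. temp_mode k n x * temp_mode k n' x) = of_bool (n = n'))
     \<and> (\<forall>n\<in>N_u. \<forall>n'\<in>N_u.
          Omega_integral k (\<lambda>x. vel_mode k n x \<bullet> vel_mode k n' x) = of_bool (n = n'))
     \<and> (\<forall>m p c m' p' c'. (m, p, c) \<in> N_u \<longrightarrow> (m', p', c') \<in> N_theta \<longrightarrow>
          Omega_integral k (\<lambda>x. vel_mode k (m, p, c) x \<bullet> (temp_mode k (m', p', c') x *\<^sub>R axis 3 1))
            = Gmat k (m, p, c) $ 3 $ 3 * nu (m, p, c) $ 3 / Gnu_norm k (m, p, c)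
              * of_bool (m = m') * of_bool (p = p'))
     \<and> (\<forall>m p c m' p' c'. (m, p, c) \<in> N_u \<longrightarrow> (m', p', c') \<in> N_u \<longrightarrow>
          Omega_integral k (\<lambda>x. cross3 (axis 3 1) (vel_mode k (m', p', c') x) \<bullet> vel_mode k (m, p, c) x)
            = (-1) ^ (of_bit (p$1) + of_bit (p$2))
              * (of_bool (m = m') * of_bool (p$1 + 1 = p'$1) * of_bool (p$2 + 1 = p'$2)
                 / (Gnu_norm k (m', p', c') * Gnu_norm k (m, p, c)))
              * (Gmat k (m', p', c') $ 2 $ 2 * Gmat k (m, p, c) $ 1 $ 1 * nu (m, p, c) $ 1
                 - Gmat k (m', p', c') $ 1 $ 1 * Gmat k (m, p, c) $ 2 $ 2 * nu (m, p, c) $ 2))"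
proof -
  interpret layer k
    using assms by unfold_locales
  show ?thesis
    using vel_mode_divergence_free vel_mode_velocity_bc temp_mode_orthonormal_basis
      vel_mode_orthonormal_basis temp_mode_inner vel_mode_inner vel_temp_inner vel_rotation_inner
    by (intro conjI ballI allI impI) simp_all
qed

end
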